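(* Let $p<p_c$ and let $(c(e))_{e\in E}$ be i.i.d. Bernoulli random variables with parameter $p$ indexed by the edges of $\mathbb L$. Then there exists $\delta>0$ such that, almost surely, $$\sup_{P}\ \limsup_{n\to\infty}\frac1n\sum_{m=1}^n c(P_m)<1-\delta,$$ where the supremum is taken over all semi-infinite vertical paths $P$ in $\mathbb L$ starting at $0$, and $c(P_m)$ denotes the cost of the $m$-th edge of $P$.
   Context: $\mathbb L=\{(x,y)\in\mathbb Z^2: x+y \text{ is even}\}$, with an edge between two points exactly when they are at Euclidean distance $\sqrt2$; $E$ is its set of edges. The law of the i.i.d. Bernoulli($p$) costs, $p\in[0,1]$, is $\mathbb P_p$. An edge is open if its cost is $1$ and closed if its cost is $0$. A path is a (finite, semi-infinite or bi-infinite) sequence of vertices of $\mathbb L$ such that consecutive vertices are joined by an edge; it is vertical if the second coordinate is monotone along the path; it is open if all its edges are open. An infinite path is one indexed by all of $\mathbb Z$; a semi-infinite path starting at $0$ is a path $(x_i)_{i\ge0}$ with $x_0=(0,0)$, whose $m$-th edge joins $x_{m-1}$ and $x_m$. The critical parameter $p_c\in(0,1)$ is the unique number such that for $p<p_c$, $\mathbb P_p$-almost surely there is no infinite vertical open path, and for $p>p_c$, $\mathbb P_p$-almost surely there is an infinite vertical open path. *)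

theory Defs
  imports "HOL-Probability.Probability"
begin

type_synonym vertex = "int \<times> int"
type_synonym edge = "vertex set"

definition even_lattice :: "vertex set" where
  "even_lattice = {(x, y). even (x + y)}"

definition to_plane :: "vertex \<Rightarrow> real \<times> real" where
  "to_plane v = (real_of_int (fst v), real_of_int (snd v))"

text \<open>The metric on \<^typ>\<open>real \<times> real\<close> is the Euclidean one.\<close>

definition lattice_edges :: "edge set" where
  "lattice_edges = {{u, v} | u v. u \<in> even_lattice \<and> v \<in> even_lattice \<and>
                                  dist (to_plane u) (to_plane v) = sqrt 2}"

text \<open>The index type is \<^typ>\<open>nat\<close> for semi-infinite paths and \<^typ>\<open>int\<close> for infinite
  (that is, bi-infinite) ones.\<close>

definition lattice_path :: "('i::{plus, one} \<Rightarrow> vertex) \<Rightarrow> bool" where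
  "lattice_path x \<longleftrightarrow> (\<forall>i. x i \<in> even_lattice \<and> {x i, x (i + 1)} \<in> lattice_edges)"

definition vertical :: "('i::order \<Rightarrow> vertex) \<Rightarrow> bool" where
  "vertical x \<longleftrightarrow> mono (\<lambda>i. snd (x i)) \<or> antimono (\<lambda>i. snd (x i))"

definition open_path :: "(edge \<Rightarrow> real) \<Rightarrow> ('i::{plus, one} \<Rightarrow> vertex) \<Rightarrow> bool" where
  "open_path c x \<longleftrightarrow> (\<forall>i. c {x i, x (i + 1)} = 1)"

definition bernoulli_cost :: "real \<Rightarrow> real measure" where
  "bernoulli_cost p = distr (measure_pmf (bernoulli_pmf p)) borel of_bool"

definition cost_law :: "real \<Rightarrow> (edge \<Rightarrow> real) measure" where
  "cost_law p = (\<Pi>\<^sub>M e\<in>lattice_edges. bernoulli_cost p)"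

definition has_infinite_vertical_open_path :: "(edge \<Rightarrow> real) \<Rightarrow> bool" where
  "has_infinite_vertical_open_path c \<longleftrightarrow>
     (\<exists>x :: int \<Rightarrow> vertex. lattice_path x \<and> vertical x \<and> open_path c x)"

text \<open>The critical parameter is specified by its defining property, which determines it by
  \<open>is_critical_parameter_unique\<close> below; its existence is a classical fact that is not proved here.\<close>

definition is_critical_parameter :: "real \<Rightarrow> bool" where
  "is_critical_parameter pc \<longleftrightarrow>
     0 < pc \<and> pc < 1 \<and>
     (\<forall>p. 0 \<le> p \<and> p < pc \<longrightarrow> (AE c in cost_law p. \<not> has_infinite_vertical_open_path c)) \<and>
     (\<forall>p. pc < p \<and> p \<le> 1 \<longrightarrow> (AE c in cost_law p. has_infinite_vertical_open_path c))"

definition semi_infinite_vertical_paths_from_origin :: "(nat \<Rightarrow> vertex) set" where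
  "semi_infinite_vertical_paths_from_origin =
     {x. lattice_path x \<and> vertical x \<and> x 0 = (0, 0)}"

lemma prob_space_bernoulli_cost: "prob_space (bernoulli_cost p)"
  unfolding bernoulli_cost_def by (rule prob_space.prob_space_distr) (auto intro: prob_space_measure_pmf)

lemma prob_space_cost_law: "prob_space (cost_law p)"
  unfolding cost_law_def by (rule prob_space_PiM) (rule prob_space_bernoulli_cost)

lemma is_critical_parameter_unique:
  assumes "is_critical_parameter a" "is_critical_parameter b"
  shows "a = b"
proof -
  have no: False if a: "is_critical_parameter a" and b: "is_critical_parameter b" and "a < b" for a b
  proof -
    obtain p where p: "a < p" "p < b" using dense[OF \<open>a < b\<close>] by blast
    have "AE c in cost_law p. has_infinite_vertical_open_path c"
      and "AE c in cost_law p. \<not> has_infinite_vertical_open_path c"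
      using a b p unfolding is_critical_parameter_def by auto
    then have "AE c in cost_law p. False" by eventually_elim simp
    then show False using prob_space.AE_False[OF prob_space_cost_law] by simp
  qed
  show ?thesis using no assms by (metis linorder_neqE)
qed

end

theory Submission
  imports Defs
begin

text \<open>The vertical paths from \<open>0\<close> are, up to a reflection, the paths of oriented bond percolation.
  For \<open>p < a < b < p\<^sub>c\<close>, the argument of Duminil-Copin and Tassion leaves two cases. Either
  \<open>\<phi>\<^sub>q(S) < 1\<close> for some \<open>q\<close> in \<open>[a, b]\<close> and some finite set \<open>S\<close> containing \<open>0\<close>, and then the
  probability at \<open>q\<close> that \<open>0\<close> is joined to level \<open>n\<close> decays exponentially; or a differential
  inequality keeps this probability at \<open>b\<close> away from \<open>0\<close>, and then the independent events that \<open>0\<close>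
  is joined to \<open>+\<infinity>\<close> and to \<open>-\<infinity>\<close> occur together with positive probability, which contradicts
  \<open>b < p\<^sub>c\<close>.

  For exponential decay at \<open>q > p\<close>, open each closed edge of the \<open>p\<close>-configuration independently
  with probability \<open>s\<close> so as to obtain the \<open>q\<close>-configuration. A path to level \<open>n\<close> with at most
  \<open>k\<close> closed edges becomes open with probability at least \<open>s\<^sup>k\<close>; hence for small \<open>\<delta>\<close> the probability
  that some path to level \<open>n\<close> has at most \<open>\<delta>n\<close> closed edges is summable in \<open>n\<close>, and Borel-Cantelli
  applies.\<close>

section \<open>Expectations over finite Bernoulli configurations\<close>

text \<open>\<open>A\<close> is the set of open elements, each open with probability
  \<open>p\<close>. The finite sum is a polynomial in \<open>p\<close>, so it can be differentiated
  and its algebraic identities hold for every real \<open>p\<close>;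
  \<open>bernoulli_field_prob\<close> relates it to a probability space.\<close>

definition bexp :: "real \<Rightarrow> 'e set \<Rightarrow> ('e set \<Rightarrow> real) \<Rightarrow> real" where
  "bexp p F f = (\<Sum>A\<in>Pow F. p ^ card A * (1 - p) ^ card (F - A) * f A)"

lemma bexp_empty [simp]: "bexp p {} f = f {}"
  by (simp add: bexp_def)

text \<open>Conditioning on whether \<open>e\<close> is open. The inductions over \<open>F\<close>
  below run through this recursion.\<close>

lemma bexp_insert:
  assumes "finite F" "e \<notin> F"
  shows "bexp p (insert e F) f = p * bexp p F (\<lambda>A. f (insert e A)) + (1 - p) * bexp p F f"
proof -
  let ?w = "\<lambda>A. p ^ card A * (1 - p) ^ card (insert e F - A) * f A"
  have disj: "Pow F \<inter> insert e ` Pow F = {}" using assms(2) by auto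
  have inj: "inj_on (insert e) (Pow F)" using assms(2) by (auto simp: inj_on_def)
  have "bexp p (insert e F) f = sum ?w (Pow F) + sum ?w (insert e ` Pow F)"
    unfolding bexp_def Pow_insert using assms(1) disj by (subst sum.union_disjoint) auto
  moreover have "sum ?w (Pow F) = (1 - p) * bexp p F f"
    unfolding bexp_def sum_distrib_left
  proof (rule sum.cong)
    fix A assume A: "A \<in> Pow F"
    then have "insert e F - A = insert e (F - A)" using assms(2) by auto
    then have "card (insert e F - A) = Suc (card (F - A))" using assms by simp
    then show "?w A = (1 - p) * (p ^ card A * (1 - p) ^ card (F - A) * f A)" by simp
  qed simp
  moreover have "sum ?w (insert e ` Pow F) = p * bexp p F (\<lambda>A. f (insert e A))"
    unfolding bexp_def sum_distrib_left sum.reindex[OF inj] comp_def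
  proof (rule sum.cong)
    fix A assume A: "A \<in> Pow F"
    then have "card (insert e A) = Suc (card A)" "insert e F - insert e A = F - A"
      using assms finite_subset by (auto intro!: card_insert_disjoint)
    then show "?w (insert e A) = p * (p ^ card A * (1 - p) ^ card (F - A) * f (insert e A))" by simp
  qed simp
  ultimately show ?thesis by simp
qed

lemma bexp_cong:
  assumes "\<And>A. A \<subseteq> F \<Longrightarrow> f A = g A"
  shows "bexp p F f = bexp p F g"
  unfolding bexp_def using assms by (intro sum.cong) auto

lemma bexp_mono:
  assumes "0 \<le> p" "p \<le> 1" "\<And>A. A \<subseteq> F \<Longrightarrow> f A \<le> g A"
  shows "bexp p F f \<le> bexp p F g"
  unfolding bexp_def using assms by (intro sum_mono mult_left_mono) auto

lemma bexp_cmult: "bexp p F (\<lambda>A. a * f A) = a * bexp p F f"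
  by (simp add: bexp_def sum_distrib_left mult.left_commute)

lemma bexp_add: "bexp p F (\<lambda>A. f A + g A) = bexp p F f + bexp p F g"
  by (simp add: bexp_def sum.distrib distrib_left)

lemma bexp_diff: "bexp p F (\<lambda>A. f A - g A) = bexp p F f - bexp p F g"
  by (simp add: bexp_def sum_subtractf right_diff_distrib)

lemma bexp_sum: "bexp p F (\<lambda>A. \<Sum>i\<in>I. f i A) = (\<Sum>i\<in>I. bexp p F (f i))"
  unfolding bexp_def sum_distrib_left by (rule sum.swap)

lemma bexp_const: "finite F \<Longrightarrow> bexp p F (\<lambda>_. a) = a"
  by (induction F rule: finite_induct) (simp_all add: bexp_insert algebra_simps)

lemma bexp_nonneg:
  assumes "0 \<le> p" "p \<le> 1" "\<And>A. A \<subseteq> F \<Longrightarrow> 0 \<le> f A"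
  shows "0 \<le> bexp p F f"
  unfolding bexp_def using assms by (intro sum_nonneg mult_nonneg_nonneg) auto

lemma bexp_le_1:
  assumes "0 \<le> p" "p \<le> 1" "finite F" "\<And>A. A \<subseteq> F \<Longrightarrow> f A \<le> 1"
  shows "bexp p F f \<le> 1"
  using bexp_mono[OF assms(1,2), of F f "\<lambda>_. 1"] assms(3,4) by (simp add: bexp_const)

lemma bexp_union:
  assumes "finite F" "finite G" "F \<inter> G = {}"
  shows "bexp p (F \<union> G) f = bexp p F (\<lambda>A. bexp p G (\<lambda>B. f (A \<union> B)))"
  using assms(1,3)
proof (induction F arbitrary: f rule: finite_induct)
  case (insert e F)
  then show ?case using assms(2) by (simp add: bexp_insert)
qed simp

lemma bexp_restrict:
  assumes "finite F" "G \<subseteq> F"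
  shows "bexp p F (\<lambda>A. f (A \<inter> G)) = bexp p G f"
proof -
  have fin: "finite G" "finite (F - G)" using assms finite_subset by auto
  have "bexp p F (\<lambda>A. f (A \<inter> G)) = bexp p (G \<union> (F - G)) (\<lambda>A. f (A \<inter> G))"
    using assms(2) by (simp add: Un_absorb1)
  also have "\<dots> = bexp p G (\<lambda>A. bexp p (F - G) (\<lambda>B. f ((A \<union> B) \<inter> G)))"
    using fin by (intro bexp_union) auto
  also have "\<dots> = bexp p G (\<lambda>A. bexp p (F - G) (\<lambda>B. f A))"
    by (intro bexp_cong arg_cong[where f=f]) auto
  finally show ?thesis using fin by (simp add: bexp_const)
qed

text \<open>Dependence on a set of edges is expressed by invariance under intersecting with it.
  Splitting \<open>F\<close> into \<open>F \<inter> G\<close> and \<open>F - G\<close> makes the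
  expectation an iterated one, in which each factor depends on one of the two variables.\<close>

lemma bexp_indep:
  assumes "finite F" "G \<inter> H = {}"
    and "\<And>A. A \<subseteq> F \<Longrightarrow> f (A \<inter> G) = f A" "\<And>A. A \<subseteq> F \<Longrightarrow> g (A \<inter> H) = g A"
  shows "bexp p F (\<lambda>A. f A * g A) = bexp p F f * bexp p F g"
proof -
  let ?H = "F - G"
  have fin: "finite (F \<inter> G)" "finite ?H" using assms by auto
  have F: "F = F \<inter> G \<union> ?H" by auto
  have g': "g A = g (A \<inter> ?H)" if "A \<subseteq> F" for A
  proof -
    have "A \<inter> ?H \<inter> H = A \<inter> H" using that assms(2) by auto
    then show ?thesis using assms(4)[OF that] assms(4)[of "A \<inter> ?H"] that by (metis Int_lower1 subset_trans)
  qed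
  have "bexp p F (\<lambda>A. f A * g A) = bexp p (F \<inter> G \<union> ?H) (\<lambda>A. f A * g A)" using F by simp
  also have "\<dots> = bexp p (F \<inter> G) (\<lambda>A. bexp p ?H (\<lambda>B. f (A \<union> B) * g (A \<union> B)))"
    using fin by (intro bexp_union) auto
  also have "\<dots> = bexp p (F \<inter> G) (\<lambda>A. bexp p ?H (\<lambda>B. f A * g B))"
  proof (intro bexp_cong arg_cong2[where f="(*)"])
    fix A B assume AB: "A \<subseteq> F \<inter> G" "B \<subseteq> ?H"
    then have sub: "A \<union> B \<subseteq> F" by auto
    have 1: "(A \<union> B) \<inter> G = A" "(A \<union> B) \<inter> ?H = B" using AB by auto
    show "f (A \<union> B) = f A" using assms(3)[OF sub] 1 by simp
    show "g (A \<union> B) = g B" using g'[OF sub] 1 by simp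
  qed
  also have "\<dots> = bexp p (F \<inter> G) f * bexp p ?H g"
    by (simp add: bexp_cmult mult.commute[of _ "bexp p ?H g"])
  also have "bexp p (F \<inter> G) f = bexp p F (\<lambda>A. f (A \<inter> (F \<inter> G)))"
    using assms(1) by (subst bexp_restrict) auto
  also have "\<dots> = bexp p F f"
  proof (rule bexp_cong)
    fix A assume "A \<subseteq> F"
    moreover from this have "A \<inter> (F \<inter> G) = A \<inter> G" by auto
    ultimately show "f (A \<inter> (F \<inter> G)) = f A" using assms(3) by simp
  qed
  also have "bexp p ?H g = bexp p F (\<lambda>A. g (A \<inter> ?H))"
    using assms(1) by (subst bexp_restrict) auto
  also have "\<dots> = bexp p F g"
    using g' by (intro bexp_cong) simp
  finally show ?thesis .
qed

lemma bexp_image: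
  assumes "finite F" "inj_on g F"
  shows "bexp p (g ` F) f = bexp p F (\<lambda>A. f (g ` A))"
  using assms
proof (induction F arbitrary: f rule: finite_induct)
  case (insert e F)
  then show ?case by (simp add: bexp_insert)
qed simp

text \<open>Russo's formula, for arbitrary \<open>f\<close>. In the induction step the product rule
  gives one term for \<open>e\<close> and the convex combination of the old derivatives; the
  difference at \<open>e\<close> does not see whether \<open>e\<close> is open.\<close>

lemma bexp_russo:
  assumes "finite F"
  shows "((\<lambda>p. bexp p F f) has_real_derivative
          (\<Sum>e\<in>F. bexp p F (\<lambda>A. f (insert e A) - f (A - {e})))) (at p)"
  using assms
proof (induction F arbitrary: f rule: finite_induct)
  case (insert e F)
  let ?g = "\<lambda>A. f (insert e A)"
  let ?D = "\<lambda>f. \<Sum>x\<in>F. bexp p F (\<lambda>A. f (insert x A) - f (A - {x}))"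
  have "((\<lambda>p. p * bexp p F ?g + (1 - p) * bexp p F f) has_real_derivative
      (bexp p F ?g - bexp p F f + (p * ?D ?g + (1 - p) * ?D f))) (at p)"
    by (rule derivative_eq_intros refl insert.IH)+ (simp add: algebra_simps)
  moreover have "bexp p (insert e F) (\<lambda>A. f (insert e A) - f (A - {e})) = bexp p F ?g - bexp p F f"
  proof -
    have "bexp p F (\<lambda>A. f (A - {e})) = bexp p F f"
      using insert.hyps by (intro bexp_cong arg_cong[where f=f]) auto
    moreover have "bexp p F (\<lambda>A. f (insert e A - {e})) = bexp p F f"
      using insert.hyps by (intro bexp_cong arg_cong[where f=f]) auto
    ultimately show ?thesis
      using insert.hyps by (simp add: bexp_insert bexp_diff algebra_simps)
  qed
  moreover have "(\<Sum>x\<in>F. bexp p (insert e F) (\<lambda>A. f (insert x A) - f (A - {x}))) =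
      p * ?D ?g + (1 - p) * ?D f"
    unfolding sum_distrib_left sum.distrib[symmetric]
  proof (rule sum.cong)
    fix x assume "x \<in> F"
    then have "e \<noteq> x" using insert.hyps by auto
    then show "bexp p (insert e F) (\<lambda>A. f (insert x A) - f (A - {x})) =
      p * bexp p F (\<lambda>A. ?g (insert x A) - ?g (A - {x})) +
      (1 - p) * bexp p F (\<lambda>A. f (insert x A) - f (A - {x}))"
      using insert.hyps by (simp add: bexp_insert insert_commute insert_Diff_if)
  qed simp
  ultimately show ?case using insert.hyps by (simp add: bexp_insert)
qed simp

text \<open>An element is closed in the union of two independent configurations iff it is closed in
  both, which has probability \<open>(1 - p) * (1 - s)\<close>.\<close>

lemma bexp_sprinkle:
  assumes "finite F"
  shows "bexp (p + (1 - p) * s) F f = bexp p F (\<lambda>A. bexp s F (\<lambda>C. f (A \<union> C)))"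
  using assms
proof (induction F arbitrary: f rule: finite_induct)
  case (insert e F)
  have "bexp p (insert e F) (\<lambda>A. bexp s (insert e F) (\<lambda>C. f (A \<union> C))) =
      (p + (1 - p) * s) * bexp p F (\<lambda>A. bexp s F (\<lambda>C. f (insert e (A \<union> C)))) +
      (1 - p) * (1 - s) * bexp p F (\<lambda>A. bexp s F (\<lambda>C. f (A \<union> C)))"
    using insert.hyps by (simp add: bexp_insert bexp_add bexp_cmult) (simp add: algebra_simps)
  moreover have "bexp (p + (1 - p) * s) (insert e F) f =
      (p + (1 - p) * s) * bexp (p + (1 - p) * s) F (\<lambda>A. f (insert e A)) +
      (1 - p) * (1 - s) * bexp (p + (1 - p) * s) F f"
    unfolding bexp_insert[OF insert.hyps(1,2)] by (simp add: algebra_simps)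
  ultimately show ?case by (simp only: insert.IH)
qed simp

lemma bexp_superset:
  assumes "finite F" "D \<subseteq> F"
  shows "bexp s F (\<lambda>C. of_bool (D \<subseteq> C)) = s ^ card D"
proof -
  have fin: "finite D" using assms finite_subset by auto
  have "bexp s F (\<lambda>C. of_bool (D \<subseteq> C)) = bexp s F (\<lambda>C. of_bool (D \<subseteq> C \<inter> D))"
    by (rule bexp_cong) auto
  also have "\<dots> = bexp s D (\<lambda>C. of_bool (D \<subseteq> C))"
    using assms by (rule bexp_restrict)
  also have "\<dots> = (\<Sum>A\<in>{D}. s ^ card A * (1 - s) ^ card (D - A) * of_bool (D \<subseteq> A))"
    unfolding bexp_def using fin by (intro sum.mono_neutral_right) auto
  finally show ?thesis by simp
qed

section \<open>Sharpness on finite directed graphs\<close>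

definition reach :: "('v \<times> 'v) set \<Rightarrow> 'v \<Rightarrow> 'v set \<Rightarrow> bool" where
  "reach A v T \<longleftrightarrow> (\<exists>t\<in>T. (v, t) \<in> A\<^sup>*)"

lemma reach_mono: "reach A v T \<Longrightarrow> A \<subseteq> B \<Longrightarrow> reach B v T"
  unfolding reach_def using rtrancl_mono by blast

lemma reach_step: "(u, v) \<in> A \<Longrightarrow> reach A v T \<Longrightarrow> reach A u T"
  unfolding reach_def by (meson converse_rtrancl_into_rtrancl)

lemma reach_target: "t \<in> T \<Longrightarrow> reach A t T"
  unfolding reach_def by auto

lemma reach_trans: "(u, v) \<in> A\<^sup>* \<Longrightarrow> reach A v T \<Longrightarrow> reach A u T"
  unfolding reach_def by (meson rtrancl_trans)

lemma reach_induct [consumes 1, case_names target step]: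
  assumes "reach A v T" "\<And>t. t \<in> T \<Longrightarrow> P t"
    and "\<And>u v. (u, v) \<in> A \<Longrightarrow> reach A v T \<Longrightarrow> P v \<Longrightarrow> P u"
  shows "P v"
proof -
  obtain t where t: "t \<in> T" "(v, t) \<in> A\<^sup>*" using assms(1) unfolding reach_def by blast
  from t(2) show ?thesis
  proof (induction rule: converse_rtrancl_induct)
    case base
    show ?case using assms(2) t(1) .
  next
    case (step y z)
    then show ?case using assms(3) t(1) unfolding reach_def by blast
  qed
qed

text \<open>Reachability of \<open>T\<close> outside \<open>S\<close> ignores the edges within \<open>S\<close>: a path
  to \<open>T\<close> never visits a vertex that cannot reach \<open>T\<close>.\<close>

lemma unreaching_set_eq_iff:
  "{x \<in> V. \<not> reach A x T} = S \<longleftrightarrow> {x \<in> V. \<not> reach (A - S \<times> S) x T} = S"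
proof
  assume S: "{x \<in> V. \<not> reach A x T} = S"
  have "reach (A - S \<times> S) x T" if "reach A x T" for x
    using that
  proof (induction rule: reach_induct)
    case (target t)
    then show ?case by (rule reach_target)
  next
    case (step u v)
    have "reach A u T" using step(1,2) by (rule reach_step)
    then have "(u, v) \<in> A - S \<times> S" using S step by auto
    then show ?case using step.IH by (rule reach_step)
  qed
  moreover have "reach A x T" if "reach (A - S \<times> S) x T" for x
    using that by (rule reach_mono) auto
  ultimately show "{x \<in> V. \<not> reach (A - S \<times> S) x T} = S" using S by blast
next
  assume S: "{x \<in> V. \<not> reach (A - S \<times> S) x T} = S"
  have "reach (A - S \<times> S) x T" if "reach A x T" for x
    using that
  proof (induction rule: reach_induct)
    case (target t)
    then show ?case by (rule reach_target)
  next
    case (step u v)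
    then have "v \<notin> S" using S by auto
    then have "(u, v) \<in> A - S \<times> S" using step by auto
    then show ?case using step.IH by (rule reach_step)
  qed
  moreover have "reach A x T" if "reach (A - S \<times> S) x T" for x
    using that by (rule reach_mono) auto
  ultimately show "{x \<in> V. \<not> reach A x T} = S" using S by blast
qed

text \<open>The quantity \<open>\<phi>\<^sub>p(S)\<close> of Duminil-Copin and Tassion, without the factor \<open>p\<close>.\<close>

definition exit_sum :: "real \<Rightarrow> ('v \<times> 'v) set \<Rightarrow> 'v \<Rightarrow> 'v set \<Rightarrow> real" where
  "exit_sum p F v S =
     (\<Sum>e\<in>F \<inter> S \<times> - S. bexp p F (\<lambda>A. of_bool ((v, fst e) \<in> (A \<inter> S \<times> S)\<^sup>*)))"

text \<open>\<open>S\<close> consists of all vertices cut off from \<open>T\<close>, so an edge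
  leaving \<open>S\<close> ends at a vertex that reaches \<open>T\<close>. Opening it completes a
  path from \<open>v\<close>, while \<open>A\<close> itself contains none.\<close>

lemma reach_pivotal:
  fixes A :: "('v \<times> 'v) set"
  assumes "{z \<in> V. \<not> reach A z T} = S" "v \<in> S" "x \<in> S" "y \<in> V" "y \<notin> S" "(v, x) \<in> (A \<inter> S \<times> S)\<^sup>*"
  shows "reach (insert (x, y) A) v T" "\<not> reach (A - {(x, y)}) v T"
proof -
  have "reach A y T" using assms by auto
  then have "reach (insert (x, y) A) y T" by (rule reach_mono) auto
  then have "reach (insert (x, y) A) x T" by (rule reach_step[rotated]) auto
  moreover have "(v, x) \<in> (insert (x, y) A)\<^sup>*"
    using assms(6) by (rule rtrancl_mono[THEN subsetD, rotated]) auto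
  ultimately show "reach (insert (x, y) A) v T" by (rule reach_trans[rotated])
  have "\<not> reach A v T" using assms by auto
  then show "\<not> reach (A - {(x, y)}) v T" using reach_mono[of "A - {(x, y)}" v T A] by auto
qed

text \<open>The right-hand side is the derivative given by \<open>bexp_russo\<close>. Decompose
  according to the random set \<open>S\<close> of vertices cut off from \<open>T\<close>: every edge
  leaving \<open>S\<close> from the cluster of \<open>v\<close> inside \<open>S\<close> is pivotal.
  The value of this random set is determined by the edges outside \<open>S \<times> S\<close> and
  the cluster by those inside, so independence produces the factor
  \<open>exit_sum p F v S\<close>.\<close>

lemma reach_russo_bound:
  fixes F :: "('v \<times> 'v) set"
  assumes "finite F" "finite V" "v \<in> V" "F \<subseteq> V \<times> V" "0 < p" "p \<le> 1"
    and exit: "\<And>S. v \<in> S \<Longrightarrow> S \<subseteq> V \<Longrightarrow> S \<inter> T = {} \<Longrightarrow> 1 \<le> p * exit_sum p F v S"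
  shows "1 - bexp p F (\<lambda>A. of_bool (reach A v T))
    \<le> (\<Sum>e\<in>F. bexp p F (\<lambda>A. of_bool (reach (insert e A) v T) - of_bool (reach (A - {e}) v T)))"
proof -
  let ?f = "\<lambda>A. of_bool (reach A v T) :: real"
  define U where "U A = {x \<in> V. \<not> reach A x T}" for A
  define I where "I A S = (of_bool (U A = S) :: real)" for A S
  define C where "C A S x = (of_bool ((v, x) \<in> (A \<inter> S \<times> S)\<^sup>*) :: real)" for A S x
  define \<S> where "\<S> = {S. v \<in> S \<and> S \<subseteq> V \<and> S \<inter> T = {}}"
  have fin: "finite \<S>" using assms(2) unfolding \<S>_def by auto
  \<comment> \<open>Targets reach \<open>T\<close> trivially, so \<open>U A\<close> always avoids
    \<open>T\<close>; only membership of \<open>v\<close> is at stake.\<close>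
  have US: "U A \<in> \<S> \<longleftrightarrow> \<not> reach A v T" for A
    using assms(3) reach_target[of _ T A] unfolding U_def \<S>_def by auto
  have one: "(\<Sum>S\<in>\<S>. I A S) = 1 - ?f A" for A
    using US[of A] fin by (simp add: I_def of_bool_def sum.delta)
  have pivot: "(\<Sum>S\<in>\<S>. I A S * (\<Sum>e\<in>F \<inter> S \<times> - S. C A S (fst e)))
      \<le> (\<Sum>e\<in>F. ?f (insert e A) - ?f (A - {e}))" for A
  proof -
    have nn: "0 \<le> ?f (insert e A) - ?f (A - {e})" for e
      using reach_mono[of "A - {e}" v T "insert e A"] by auto
    show ?thesis
    proof (cases "U A \<in> \<S>")
      case True
      then have v: "v \<in> U A" unfolding \<S>_def by auto
      have "(\<Sum>S\<in>\<S>. I A S * (\<Sum>e\<in>F \<inter> S \<times> - S. C A S (fst e)))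
          = (\<Sum>S\<in>{U A}. I A S * (\<Sum>e\<in>F \<inter> S \<times> - S. C A S (fst e)))"
        using True fin by (intro sum.mono_neutral_right) (auto simp: I_def)
      also have "\<dots> = (\<Sum>e\<in>F \<inter> U A \<times> - U A. C A (U A) (fst e))"
        by (simp add: I_def)
      also have "\<dots> \<le> (\<Sum>e\<in>F \<inter> U A \<times> - U A. ?f (insert e A) - ?f (A - {e}))"
      proof (rule sum_mono)
        fix e assume e: "e \<in> F \<inter> U A \<times> - U A"
        obtain x y where xy: "e = (x, y)" by (cases e)
        have "y \<in> V" using e assms(4) xy by auto
        then show "C A (U A) (fst e) \<le> ?f (insert e A) - ?f (A - {e})"
          using reach_pivotal[OF U_def[of A, symmetric] v, of x y] e nn[of e] unfolding xy C_def
          by (cases "(v, x) \<in> (A \<inter> U A \<times> U A)\<^sup>*") auto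
      qed
      also have "\<dots> \<le> (\<Sum>e\<in>F. ?f (insert e A) - ?f (A - {e}))"
        using assms(1) nn by (intro sum_mono2) auto
      finally show ?thesis .
    next
      case False
      then have "(\<Sum>S\<in>\<S>. I A S * (\<Sum>e\<in>F \<inter> S \<times> - S. C A S (fst e))) = 0"
        by (intro sum.neutral) (auto simp: I_def)
      then show ?thesis using nn by (simp add: sum_nonneg)
    qed
  qed
  have "1 - bexp p F ?f = bexp p F (\<lambda>A. \<Sum>S\<in>\<S>. I A S)"
    using assms(1) by (simp add: one bexp_diff bexp_const)
  also have "\<dots> = (\<Sum>S\<in>\<S>. bexp p F (\<lambda>A. I A S))" by (rule bexp_sum)
  also have "\<dots> \<le> (\<Sum>S\<in>\<S>. bexp p F (\<lambda>A. I A S) * exit_sum p F v S)"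
  proof (rule sum_mono)
    fix S assume S: "S \<in> \<S>"
    have C0: "0 \<le> exit_sum p F v S"
      unfolding exit_sum_def using assms(5,6) by (intro sum_nonneg bexp_nonneg) auto
    have "1 \<le> p * exit_sum p F v S" using S exit unfolding \<S>_def by auto
    also have "\<dots> \<le> 1 * exit_sum p F v S" using C0 assms(6) by (rule mult_right_mono[rotated])
    finally have "1 \<le> exit_sum p F v S" by simp
    moreover have "0 \<le> bexp p F (\<lambda>A. I A S)"
      using assms(5,6) by (intro bexp_nonneg) (auto simp: I_def)
    ultimately show "bexp p F (\<lambda>A. I A S) \<le> bexp p F (\<lambda>A. I A S) * exit_sum p F v S"
      using mult_left_mono[of 1 "exit_sum p F v S" "bexp p F (\<lambda>A. I A S)"] by simp
  qed
  also have "\<dots> = (\<Sum>S\<in>\<S>. \<Sum>e\<in>F \<inter> S \<times> - S. bexp p F (\<lambda>A. I A S * C A S (fst e)))"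
    unfolding exit_sum_def sum_distrib_left
  proof (intro sum.cong refl)
    fix S e
    \<comment> \<open>\<open>unreaching_set_eq_iff\<close> supplies the dependence of
      \<open>I\<close> on the edges outside \<open>S \<times> S\<close> alone.\<close>
    have "bexp p F (\<lambda>A. I A S * C A S (fst e)) = bexp p F (\<lambda>A. I A S) * bexp p F (\<lambda>A. C A S (fst e))"
    proof (rule bexp_indep[where G = "F - S \<times> S" and H = "S \<times> S"])
      fix A assume "A \<subseteq> F"
      then have "A \<inter> (F - S \<times> S) = A - S \<times> S" by auto
      then show "I (A \<inter> (F - S \<times> S)) S = I A S"
        unfolding I_def U_def using unreaching_set_eq_iff[of V A T S] by simp
    qed (use assms(1) in \<open>auto simp: C_def\<close>)
    then show "bexp p F (\<lambda>A. I A S) * bexp p F (\<lambda>A. of_bool ((v, fst e) \<in> (A \<inter> S \<times> S)\<^sup>*))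
        = bexp p F (\<lambda>A. I A S * C A S (fst e))"
      by (simp add: C_def)
  qed
  also have "\<dots> = bexp p F (\<lambda>A. \<Sum>S\<in>\<S>. I A S * (\<Sum>e\<in>F \<inter> S \<times> - S. C A S (fst e)))"
    by (simp add: bexp_sum sum_distrib_left)
  also have "\<dots> \<le> bexp p F (\<lambda>A. \<Sum>e\<in>F. ?f (insert e A) - ?f (A - {e}))"
    using assms(5,6) pivot by (intro bexp_mono) auto
  also have "\<dots> = (\<Sum>e\<in>F. bexp p F (\<lambda>A. ?f (insert e A) - ?f (A - {e})))"
    by (rule bexp_sum)
  finally show ?thesis .
qed

text \<open>With \<theta> the connection probability, \<open>reach_russo_bound\<close> says that
  \<theta>' is at least 1 - \<theta>, so \<open>(1 - \<theta> p) * exp p\<close> is nonincreasing on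
  [a, b]. Comparing the endpoints gives the bound, which is uniform in the graph.\<close>

lemma reach_prob_lower_bound:
  fixes F :: "('v \<times> 'v) set"
  assumes "finite F" "finite V" "v \<in> V" "F \<subseteq> V \<times> V" "0 < a" "a \<le> b" "b \<le> 1"
    and exit: "\<And>S p. a \<le> p \<Longrightarrow> p \<le> b \<Longrightarrow> v \<in> S \<Longrightarrow> S \<subseteq> V \<Longrightarrow> S \<inter> T = {} \<Longrightarrow>
      1 \<le> p * exit_sum p F v S"
  shows "1 - exp (a - b) \<le> bexp b F (\<lambda>A. of_bool (reach A v T))"
proof -
  let ?f = "\<lambda>A. of_bool (reach A v T) :: real"
  let ?\<theta> = "\<lambda>p. bexp p F ?f"
  let ?D = "\<lambda>p. \<Sum>e\<in>F. bexp p F (\<lambda>A. ?f (insert e A) - ?f (A - {e}))"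
  have "(1 - ?\<theta> b) * exp b \<le> (1 - ?\<theta> a) * exp a"
  proof (rule DERIV_nonpos_imp_nonincreasing[OF assms(6)])
    fix p assume p: "a \<le> p" "p \<le> b"
    have "((\<lambda>p. (1 - ?\<theta> p) * exp p) has_real_derivative (1 - ?\<theta> p - ?D p) * exp p) (at p)"
      by (rule derivative_eq_intros bexp_russo assms(1) refl)+ (simp add: algebra_simps)
    moreover have "1 - ?\<theta> p \<le> ?D p"
      using assms(1-5,7) p exit by (intro reach_russo_bound) auto
    then have "(1 - ?\<theta> p - ?D p) * exp p \<le> 0" by (simp add: mult_nonpos_nonneg)
    ultimately show "\<exists>y. ((\<lambda>p. (1 - ?\<theta> p) * exp p) has_real_derivative y) (at p) \<and> y \<le> 0" by blast
  qed
  also have "\<dots> \<le> 1 * exp a"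
    using assms(5-7) by (intro mult_right_mono) (auto intro!: bexp_nonneg)
  finally have "(1 - ?\<theta> b) * exp b * exp (- b) \<le> exp a * exp (- b)"
    by (intro mult_right_mono) auto
  then show ?thesis by (simp add: mult.assoc exp_minus_inverse exp_add[symmetric])
qed

text \<open>The Simon-Lieb inequality: at its last visit to the cluster of \<open>v\<close> within \<open>S\<close>, a
  path from \<open>v\<close> to \<open>T\<close> leaves \<open>S\<close>, and afterwards it uses only edges which that cluster
  does not touch.\<close>

lemma reach_last_exit:
  assumes "reach A v T" "S \<inter> T = {}" "v \<in> S"
  defines "X \<equiv> {x. (v, x) \<in> (A \<inter> S \<times> S)\<^sup>*}"
  shows "\<exists>(x, y)\<in>A \<inter> X \<times> - S. reach (A \<inter> (- X) \<times> (- X)) y T"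
proof -
  have XS: "X \<subseteq> S"
  proof
    fix x assume "x \<in> X"
    then have "(v, x) \<in> (A \<inter> S \<times> S)\<^sup>*" unfolding X_def by simp
    then show "x \<in> S" using assms(3) by (induction rule: rtrancl_induct) auto
  qed
  \<comment> \<open>Follow the path backwards from \<open>T\<close>: as long as no exit edge has
    been found, the part already traversed avoids \<open>X\<close>. The first step into
    \<open>X\<close> must start outside \<open>S\<close>, since otherwise its starting point would
    belong to \<open>X\<close> as well.\<close>
  have "(z \<notin> X \<and> reach (A \<inter> (- X) \<times> (- X)) z T) \<or> ?thesis" if "reach A z T" for z
    using that
  proof (induction rule: reach_induct)
    case (target t)
    then show ?case using XS assms(2) reach_target[of t T] by auto
  next
    case (step z w)
    show ?case
    proof (cases "w \<notin> X \<and> reach (A \<inter> (- X) \<times> (- X)) w T")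
      case w: True
      show ?thesis
      proof (cases "z \<in> X")
        case True
        have "w \<notin> S"
        proof
          assume "w \<in> S"
          then have "(z, w) \<in> A \<inter> S \<times> S" using True XS step(1) by auto
          then have "w \<in> X" using True unfolding X_def by (auto intro: rtrancl_into_rtrancl)
          then show False using w by simp
        qed
        then show ?thesis using True w step(1) by blast
      next
        case False
        then have "(z, w) \<in> A \<inter> (- X) \<times> (- X)" using w step(1) by auto
        then show ?thesis using False w reach_step[of z w "A \<inter> (- X) \<times> (- X)" T] by simp
      qed
    qed (use step.IH in blast)
  qed
  moreover have "v \<in> X" unfolding X_def by simp
  ultimately show ?thesis using assms(1) by blast
qed

text \<open>Exploring the cluster from \<open>v\<close> only inspects edges that start at vertices
  already found. Hence the event that the cluster equals \<open>C\<close> is decided by the edges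
  from \<open>C\<close> into \<open>S\<close>.\<close>

lemma inner_cluster_eq_iff:
  "{x. (v, x) \<in> (A \<inter> S \<times> S)\<^sup>*} = C \<longleftrightarrow> {x. (v, x) \<in> (A \<inter> C \<times> S \<inter> S \<times> S)\<^sup>*} = C"
proof -
  let ?R = "A \<inter> S \<times> S" and ?Q = "A \<inter> C \<times> S \<inter> S \<times> S"
  have QR: "(v, x) \<in> ?Q\<^sup>* \<Longrightarrow> (v, x) \<in> ?R\<^sup>*" for x
    by (rule rtrancl_mono[THEN subsetD]) auto
  show ?thesis
  proof
    assume C: "{x. (v, x) \<in> ?R\<^sup>*} = C"
    have "(v, x) \<in> ?Q\<^sup>*" if "(v, x) \<in> ?R\<^sup>*" for x
      using that
    proof (induction rule: rtrancl_induct)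
      case (step y z)
      then have "(y, z) \<in> ?Q" using C by auto
      then show ?case using step.IH by (rule rtrancl_into_rtrancl[rotated])
    qed simp
    then show "{x. (v, x) \<in> ?Q\<^sup>*} = C" using QR C by blast
  next
    assume C: "{x. (v, x) \<in> ?Q\<^sup>*} = C"
    have "(v, x) \<in> ?Q\<^sup>*" if "(v, x) \<in> ?R\<^sup>*" for x
      using that
    proof (induction rule: rtrancl_induct)
      case (step y z)
      then have "(y, z) \<in> ?Q" using C by auto
      then show ?case using step.IH by (rule rtrancl_into_rtrancl[rotated])
    qed simp
    then show "{x. (v, x) \<in> ?R\<^sup>*} = C" using QR C by blast
  qed
qed

text \<open>Sum over the value \<open>C\<close> of the cluster of \<open>v\<close> in
  \<open>S\<close> and over the exit edge \<open>e\<close> from \<open>reach_last_exit\<close>. The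
  cluster being \<open>C\<close>, the edge \<open>e\<close> being open, and the head of
  \<open>e\<close> reaching \<open>T\<close> off \<open>C\<close> depend on pairwise disjoint sets
  of edges, so the probabilities multiply.\<close>

lemma simon_lieb:
  fixes F :: "('v \<times> 'v) set"
  assumes "finite F" "finite S" "v \<in> S" "S \<inter> T = {}" "0 \<le> p" "p \<le> 1"
    and m: "\<And>x y. (x, y) \<in> F \<Longrightarrow> x \<in> S \<Longrightarrow> y \<notin> S \<Longrightarrow> bexp p F (\<lambda>A. of_bool (reach A y T)) \<le> m"
  shows "bexp p F (\<lambda>A. of_bool (reach A v T)) \<le> p * exit_sum p F v S * m"
proof -
  let ?ob = "of_bool :: bool \<Rightarrow> real"
  define X where "X A = {x. (v, x) \<in> (A \<inter> S \<times> S)\<^sup>*}" for A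
  define R where "R A C y = reach (A \<inter> (- C) \<times> (- C)) y T" for A C y
  have XS: "X A \<in> Pow S" for A
  proof -
    have "x \<in> S" if "(v, x) \<in> (A \<inter> S \<times> S)\<^sup>*" for x
      using that assms(3) by (induction rule: rtrancl_induct) auto
    then show ?thesis unfolding X_def by auto
  qed
  have finS: "finite (Pow S)" "finite (F \<inter> S \<times> - S)" using assms(1,2) by auto
  have "bexp p F (\<lambda>A. ?ob (reach A v T))
      \<le> bexp p F (\<lambda>A. \<Sum>C\<in>Pow S. \<Sum>e\<in>F \<inter> S \<times> - S. ?ob (fst e \<in> C) *
           (?ob (X A = C) * (?ob (e \<in> A) * ?ob (R A C (snd e)))))"
  proof (rule bexp_mono[OF assms(5,6)])
    fix A assume A: "A \<subseteq> F"
    let ?g = "\<lambda>C e. ?ob (fst e \<in> C) * (?ob (X A = C) * (?ob (e \<in> A) * ?ob (R A C (snd e))))"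
    show "?ob (reach A v T) \<le> (\<Sum>C\<in>Pow S. \<Sum>e\<in>F \<inter> S \<times> - S. ?g C e)"
    proof (cases "reach A v T")
      case True
      obtain x y where xy: "(x, y) \<in> A" "x \<in> X A" "y \<notin> S" "R A (X A) y"
        using reach_last_exit[OF True assms(4,3)] unfolding R_def X_def by blast
      then have mem: "(x, y) \<in> F \<inter> S \<times> - S" using XS[of A] A by auto
      have "?ob (reach A v T) \<le> ?g (X A) (x, y)" using xy by simp
      also have "\<dots> \<le> (\<Sum>e\<in>F \<inter> S \<times> - S. ?g (X A) e)"
        using mem finS(2) by (intro member_le_sum) auto
      also have "\<dots> \<le> (\<Sum>C\<in>Pow S. \<Sum>e\<in>F \<inter> S \<times> - S. ?g C e)"
        using XS finS(1) by (intro member_le_sum[where f = "\<lambda>C. \<Sum>e\<in>F \<inter> S \<times> - S. ?g C e"] sum_nonneg) auto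
      finally show ?thesis .
    qed (auto intro!: sum_nonneg)
  qed
  also have "\<dots> = (\<Sum>C\<in>Pow S. \<Sum>e\<in>F \<inter> S \<times> - S. ?ob (fst e \<in> C) *
           bexp p F (\<lambda>A. ?ob (X A = C) * (?ob (e \<in> A) * ?ob (R A C (snd e)))))"
    by (simp only: bexp_sum bexp_cmult)
  also have "\<dots> \<le> (\<Sum>C\<in>Pow S. \<Sum>e\<in>F \<inter> S \<times> - S. ?ob (fst e \<in> C) *
           (bexp p F (\<lambda>A. ?ob (X A = C)) * (p * m)))"
  proof (intro sum_mono)
    fix C e assume C: "C \<in> Pow S" and e: "e \<in> F \<inter> S \<times> - S"
    let ?B = "bexp p F (\<lambda>A. ?ob (X A = C) * (?ob (e \<in> A) * ?ob (R A C (snd e))))"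
    show "?ob (fst e \<in> C) * ?B \<le> ?ob (fst e \<in> C) * (bexp p F (\<lambda>A. ?ob (X A = C)) * (p * m))"
    proof (cases "fst e \<in> C")
      case True
      have "?B = bexp p F (\<lambda>A. ?ob (X A = C)) * bexp p F (\<lambda>A. ?ob (e \<in> A) * ?ob (R A C (snd e)))"
      \<comment> \<open>The edge \<open>e\<close> ends outside \<open>S\<close>, and the edges used
        after the exit start outside \<open>C\<close>; neither kind lies in
        \<open>C \<times> S\<close>.\<close>
      proof (rule bexp_indep[where G = "C \<times> S" and H = "- (C \<times> S)"])
        fix A
        show "?ob (X (A \<inter> C \<times> S) = C) = ?ob (X A = C)"
          using inner_cluster_eq_iff[of v A S C] unfolding X_def by (simp add: Int_assoc)
        let ?H = "- (C \<times> S)"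
        have "e \<in> ?H" using e by (cases e) auto
        moreover have "A \<inter> ?H \<inter> (- C) \<times> (- C) = A \<inter> (- C) \<times> (- C)" by auto
        ultimately show "?ob (e \<in> A \<inter> ?H) * ?ob (R (A \<inter> ?H) C (snd e)) = ?ob (e \<in> A) * ?ob (R A C (snd e))"
          unfolding R_def by simp
      qed (use assms(1) in auto)
      also have "bexp p F (\<lambda>A. ?ob (e \<in> A) * ?ob (R A C (snd e)))
          = bexp p F (\<lambda>A. ?ob (e \<in> A)) * bexp p F (\<lambda>A. ?ob (R A C (snd e)))"
      proof (rule bexp_indep[where G = "{e}" and H = "(- C) \<times> (- C)"])
        show "{e} \<inter> (- C) \<times> (- C) = {}" using True by auto
      qed (use assms(1) in \<open>auto simp: R_def\<close>)
      also have "bexp p F (\<lambda>A. ?ob (e \<in> A)) = p"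
        using bexp_superset[OF assms(1), of "{e}" p] e by simp
      also have "bexp p F (\<lambda>A. ?ob (X A = C)) * (p * bexp p F (\<lambda>A. ?ob (R A C (snd e))))
          \<le> bexp p F (\<lambda>A. ?ob (X A = C)) * (p * m)"
      proof (intro mult_left_mono)
        have "bexp p F (\<lambda>A. ?ob (R A C (snd e))) \<le> bexp p F (\<lambda>A. ?ob (reach A (snd e) T))"
          using reach_mono[of _ "snd e" T] unfolding R_def by (intro bexp_mono assms(5,6)) simp
        also have "\<dots> \<le> m" using m[of "fst e" "snd e"] e by auto
        finally show "bexp p F (\<lambda>A. ?ob (R A C (snd e))) \<le> m" .
      qed (use assms(5,6) in \<open>auto intro: bexp_nonneg\<close>)
      finally show ?thesis using True by simp
    qed simp
  qed
  \<comment> \<open>Summing over \<open>C\<close> first recovers the probability that the tail of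
    \<open>e\<close> lies in the cluster.\<close>
  also have "\<dots> = (\<Sum>e\<in>F \<inter> S \<times> - S. (\<Sum>C\<in>Pow S. bexp p F (\<lambda>A. ?ob (fst e \<in> C) * ?ob (X A = C)))) * (p * m)"
    by (subst sum.swap) (simp only: sum_distrib_right bexp_cmult mult.assoc)
  also have "(\<Sum>e\<in>F \<inter> S \<times> - S. (\<Sum>C\<in>Pow S. bexp p F (\<lambda>A. ?ob (fst e \<in> C) * ?ob (X A = C))))
      = exit_sum p F v S"
    unfolding exit_sum_def bexp_sum[symmetric]
  proof (intro sum.cong bexp_cong refl)
    fix e A
    have "(\<Sum>C\<in>Pow S. ?ob (fst e \<in> C) * ?ob (X A = C)) = (\<Sum>C\<in>{X A}. ?ob (fst e \<in> C) * ?ob (X A = C))"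
      using XS finS(1) by (intro sum.mono_neutral_right) auto
    then show "(\<Sum>C\<in>Pow S. ?ob (fst e \<in> C) * ?ob (X A = C)) = ?ob ((v, fst e) \<in> (A \<inter> S \<times> S)\<^sup>*)"
      by (simp add: X_def)
  qed
  finally show ?thesis by (simp add: mult_ac)
qed

section \<open>Oriented paths in the lattice\<close>

text \<open>Each lattice edge appears once, directed upwards, so that vertical paths become directed
  paths. The parity of \<open>w\<close> follows from that of \<open>u\<close>, see
  \<open>up_edges_even\<close>.\<close>

definition up_edges :: "(vertex \<times> vertex) set" where
  "up_edges = {(u, w). u \<in> even_lattice \<and> snd w = snd u + 1 \<and> \<bar>fst w - fst u\<bar> = 1}"

lemma up_edges_even:
  assumes "(u, w) \<in> up_edges"
  shows "w \<in> even_lattice"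
proof -
  have "even (fst u + snd u)" "snd w = snd u + 1" "\<bar>fst w - fst u\<bar> = 1"
    using assms by (auto simp: up_edges_def even_lattice_def)
  then have "even (fst w + snd w)" by presburger
  then show ?thesis by (auto simp: even_lattice_def)
qed

definition level :: "int \<Rightarrow> vertex set" where
  "level k = {w. snd w = k}"

text \<open>The edges that an upward path from \<open>v\<close> can use before level
  \<open>k\<close>. There are finitely many, so connection to level \<open>k\<close> becomes an
  event for \<open>bexp\<close>.\<close>

definition cone :: "vertex \<Rightarrow> int \<Rightarrow> (vertex \<times> vertex) set" where
  "cone v k = {(u, w) \<in> up_edges. snd v \<le> snd u \<and> snd u < k \<and> \<bar>fst u - fst v\<bar> \<le> snd u - snd v}"

definition cone_vertices :: "int \<Rightarrow> vertex set" where
  "cone_vertices k = {w. 0 \<le> snd w \<and> snd w \<le> k \<and> \<bar>fst w\<bar> \<le> snd w}"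

definition connect_prob :: "real \<Rightarrow> nat \<Rightarrow> real" where
  "connect_prob p n = bexp p (cone 0 (int n)) (\<lambda>A. of_bool (reach A 0 (level (int n))))"

lemma finite_cone_vertices: "finite (cone_vertices k)"
  by (rule finite_subset[of _ "{-k..k} \<times> {0..k}"]) (auto simp: cone_vertices_def)

lemma cone_subset_vertices: "cone 0 k \<subseteq> cone_vertices k \<times> cone_vertices k"
  by (auto simp: cone_def up_edges_def cone_vertices_def)

lemma finite_cone_origin: "finite (cone 0 k)"
  using cone_subset_vertices finite_cone_vertices by (meson finite_SigmaI finite_subset)

lemma cone_subset_up_edges: "cone v k \<subseteq> up_edges"
  by (auto simp: cone_def)

lemma cone_translate:
  assumes "v \<in> even_lattice"
  shows "cone v (snd v + k) = map_prod ((+) v) ((+) v) ` cone 0 k"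
proof -
  have shift: "(v + u, v + w) \<in> cone v (snd v + k) \<longleftrightarrow> (u, w) \<in> cone 0 k" for u w
  proof -
    have "v + u \<in> even_lattice \<longleftrightarrow> u \<in> even_lattice"
      using assms by (cases u; cases v) (auto simp: even_lattice_def)
    then show ?thesis by (simp add: cone_def up_edges_def)
  qed
  show ?thesis
  proof (rule set_eqI)
    fix e :: "vertex \<times> vertex"
    have "e \<in> cone v (snd v + k) \<longleftrightarrow> (fst e - v, snd e - v) \<in> cone 0 k"
      using shift[of "fst e - v" "snd e - v"] by simp
    also have "\<dots> \<longleftrightarrow> e \<in> map_prod ((+) v) ((+) v) ` cone 0 k"
    proof
      assume "(fst e - v, snd e - v) \<in> cone 0 k"
      then show "e \<in> map_prod ((+) v) ((+) v) ` cone 0 k"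
        by (rule image_eqI[rotated]) (simp add: prod_eq_iff)
    next
      assume "e \<in> map_prod ((+) v) ((+) v) ` cone 0 k"
      then obtain u w where "(u, w) \<in> cone 0 k" "e = (v + u, v + w)" by auto
      then show "(fst e - v, snd e - v) \<in> cone 0 k" by simp
    qed
    finally show "e \<in> cone v (snd v + k) \<longleftrightarrow> e \<in> map_prod ((+) v) ((+) v) ` cone 0 k" .
  qed
qed

lemma reach_image:
  assumes "inj h" "reach (map_prod h h ` A) (h v) T"
  shows "reach A v (h -` T)"
proof -
  obtain t where t: "t \<in> T" "(h v, t) \<in> (map_prod h h ` A)\<^sup>*"
    using assms(2) unfolding reach_def by blast
  have "\<exists>w. t = h w \<and> (v, w) \<in> A\<^sup>*"
    using t(2)
  proof (induction rule: rtrancl_induct)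
    case (step y z)
    then obtain w where w: "y = h w" "(v, w) \<in> A\<^sup>*" by blast
    obtain a b where ab: "(a, b) \<in> A" "y = h a" "z = h b" using step(2) by auto
    then have "a = w" using w assms(1) by (auto dest: injD)
    then show ?case using ab w by (auto intro: rtrancl_into_rtrancl)
  qed blast
  then show ?thesis using t(1) unfolding reach_def by auto
qed

lemma up_path_in_cone:
  assumes "A \<subseteq> up_edges" "(v, z) \<in> A\<^sup>*" "snd z \<le> k"
  shows "(v, z) \<in> (A \<inter> cone v k)\<^sup>* \<and> \<bar>fst z - fst v\<bar> \<le> snd z - snd v"
  using assms(2,3)
proof (induction rule: rtrancl_induct)
  case (step y z)
  have up: "(y, z) \<in> up_edges" using step(2) assms(1) by auto
  then have "snd y < k" using step(4) by (auto simp: up_edges_def)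
  then have IH: "(v, y) \<in> (A \<inter> cone v k)\<^sup>*" "\<bar>fst y - fst v\<bar> \<le> snd y - snd v"
    using step.IH by auto
  then have "(y, z) \<in> A \<inter> cone v k"
    using step(2) up \<open>snd y < k\<close> by (auto simp: cone_def)
  moreover have "\<bar>fst z - fst v\<bar> \<le> snd z - snd v" using IH(2) up by (auto simp: up_edges_def)
  ultimately show ?case using IH(1) by (auto intro: rtrancl_into_rtrancl)
qed simp

lemma up_path_crosses_level:
  assumes "A \<subseteq> up_edges" "(v, z) \<in> A\<^sup>*" "snd v \<le> k" "k \<le> snd z"
  shows "\<exists>w. (v, w) \<in> A\<^sup>* \<and> snd w = k"
  using assms(2,4)
proof (induction rule: rtrancl_induct)
  case (step y z)
  have "(y, z) \<in> up_edges" using step(2) assms(1) by auto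
  then have "snd z = snd y + 1" by (auto simp: up_edges_def)
  then consider "k \<le> snd y" | "snd z = k" using step(4) by linarith
  then show ?case
  proof cases
    case 1
    then show ?thesis by (rule step.IH)
  next
    case 2
    then show ?thesis using rtrancl_into_rtrancl[OF step(1,2)] by blast
  qed
next
  case base
  then have "snd v = k" using assms(3) by simp
  then show ?case by blast
qed

text \<open>Each step gains exactly one level, so a path to level \<open>k'\<close> meets level
  \<open>k\<close>, and its horizontal displacement until then never exceeds its gain in
  height.\<close>

lemma reach_level_in_cone:
  assumes "A \<subseteq> up_edges" "snd v \<le> k" "k \<le> k'" "reach A v (level k')"
  shows "reach (A \<inter> cone v k) v (level k)"
proof -
  obtain z where "(v, z) \<in> A\<^sup>*" "snd z = k'" using assms(4) by (auto simp: reach_def level_def)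
  then obtain w where w: "(v, w) \<in> A\<^sup>*" "snd w = k"
    using up_path_crosses_level[OF assms(1) _ assms(2)] assms(3) by blast
  then have "(v, w) \<in> (A \<inter> cone v k)\<^sup>*" using up_path_in_cone[OF assms(1) w(1), of k] by simp
  then show ?thesis using w(2) unfolding reach_def level_def by blast
qed

section \<open>Connection probabilities and the dichotomy between decay and percolation\<close>

lemma connect_prob_nonneg: "0 \<le> p \<Longrightarrow> p \<le> 1 \<Longrightarrow> 0 \<le> connect_prob p n"
  unfolding connect_prob_def by (intro bexp_nonneg) auto

lemma connect_prob_le_1: "0 \<le> p \<Longrightarrow> p \<le> 1 \<Longrightarrow> connect_prob p n \<le> 1"
  unfolding connect_prob_def by (intro bexp_le_1 finite_cone_origin) auto

lemma connect_prob_antimono: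
  assumes "0 \<le> p" "p \<le> 1" "m \<le> n"
  shows "connect_prob p n \<le> connect_prob p m"
proof -
  have "connect_prob p n \<le> bexp p (cone 0 (int n))
      (\<lambda>A. of_bool (reach (A \<inter> cone 0 (int m)) 0 (level (int m))))"
    unfolding connect_prob_def
  proof (rule bexp_mono[OF assms(1,2)])
    fix A :: "(vertex \<times> vertex) set" assume "A \<subseteq> cone 0 (int n)"
    then have "A \<subseteq> up_edges" using cone_subset_up_edges by blast
    then show "of_bool (reach A 0 (level (int n)))
        \<le> (of_bool (reach (A \<inter> cone 0 (int m)) 0 (level (int m))) :: real)"
      using reach_level_in_cone[of A 0 "int m" "int n"] assms(3) by auto
  qed
  also have "\<dots> = connect_prob p m"
    unfolding connect_prob_def
  proof (rule bexp_restrict[OF finite_cone_origin])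
    show "cone 0 (int m) \<subseteq> cone 0 (int n)" using assms(3) by (auto simp: cone_def)
  qed
  finally show ?thesis .
qed

text \<open>Translation invariance: only the cone of \<open>v\<close> matters, and it is a translate
  of a cone at the origin. The truncated difference is exact because \<open>snd v\<close> lies
  between 0 and \<open>n\<close>.\<close>

lemma connect_prob_from:
  assumes "0 \<le> p" "p \<le> 1" "v \<in> even_lattice" "v \<in> cone_vertices (int n)"
  shows "bexp p (cone 0 (int n)) (\<lambda>A. of_bool (reach A v (level (int n))))
    \<le> connect_prob p (n - nat (snd v))"
proof -
  have v: "0 \<le> snd v" "snd v \<le> int n" "\<bar>fst v\<bar> \<le> snd v"
    using assms(4) unfolding cone_vertices_def by auto
  define k where "k = n - nat (snd v)"
  have k: "snd v + int k = int n" unfolding k_def using v by linarith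
  have "bexp p (cone 0 (int n)) (\<lambda>A. of_bool (reach A v (level (int n))))
    \<le> bexp p (cone 0 (int n)) (\<lambda>A. of_bool (reach (A \<inter> cone v (int n)) v (level (int n))))"
  proof (rule bexp_mono[OF assms(1,2)])
    fix A :: "(vertex \<times> vertex) set" assume "A \<subseteq> cone 0 (int n)"
    then have "A \<subseteq> up_edges" using cone_subset_up_edges by blast
    then show "of_bool (reach A v (level (int n)))
        \<le> (of_bool (reach (A \<inter> cone v (int n)) v (level (int n))) :: real)"
      using reach_level_in_cone[of A v "int n" "int n"] v by auto
  qed
  also have "\<dots> = bexp p (cone v (int n)) (\<lambda>A. of_bool (reach A v (level (int n))))"
  proof (rule bexp_restrict[OF finite_cone_origin])
    show "cone v (int n) \<subseteq> cone 0 (int n)"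
    proof
      fix e assume e: "e \<in> cone v (int n)"
      then have "snd v \<le> snd (fst e)" "\<bar>fst (fst e) - fst v\<bar> \<le> snd (fst e) - snd v"
        by (auto simp: cone_def)
      then have "0 \<le> snd (fst e)" "\<bar>fst (fst e)\<bar> \<le> snd (fst e)" using v by linarith+
      then show "e \<in> cone 0 (int n)" using e by (auto simp: cone_def)
    qed
  qed
  also have "\<dots> = bexp p (map_prod ((+) v) ((+) v) ` cone 0 (int k)) (\<lambda>A. of_bool (reach A v (level (int n))))"
    unfolding k[symmetric] cone_translate[OF assms(3)] ..
  also have "\<dots> = bexp p (cone 0 (int k))
      (\<lambda>A. of_bool (reach (map_prod ((+) v) ((+) v) ` A) v (level (int n))))"
    by (rule bexp_image[OF finite_cone_origin]) (auto simp: inj_on_def)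
  also have "\<dots> \<le> connect_prob p k"
    unfolding connect_prob_def
  proof (rule bexp_mono[OF assms(1,2)])
    fix A :: "(vertex \<times> vertex) set"
    have "(+) v -` level (int n) = level (int k)" using k by (auto simp: level_def simp flip: k)
    then show "of_bool (reach (map_prod ((+) v) ((+) v) ` A) v (level (int n)))
        \<le> (of_bool (reach A 0 (level (int k))) :: real)"
      using reach_image[of "(+) v" A 0 "level (int n)"] by simp
  qed
  finally show ?thesis unfolding k_def .
qed

text \<open>All vertices of \<open>S\<close> lie strictly below level \<open>L\<close>, so the edges
  starting in \<open>S\<close> are the same in both cones. The factor in the Simon-Lieb inequality
  is thus independent of \<open>n\<close>, which allows iteration.\<close>

lemma exit_sum_cone:
  assumes "L \<le> n" "S \<subseteq> cone_vertices L" "S \<inter> level L = {}"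
  shows "exit_sum p (cone 0 n) v S = exit_sum p (cone 0 L) v S"
proof -
  have lt: "snd x < L" if "x \<in> S" for x
    using that assms(2,3) unfolding cone_vertices_def level_def by fastforce
  have sub: "cone 0 L \<subseteq> cone 0 n" using assms(1) by (auto simp: cone_def)
  have mem: "(x, y) \<in> cone 0 n \<longleftrightarrow> (x, y) \<in> cone 0 L" if "x \<in> S" for x y
    using lt[OF that] assms(1) by (auto simp: cone_def)
  then have eq: "cone 0 n \<inter> S \<times> B = cone 0 L \<inter> S \<times> B" for B
    by auto
  have "bexp p (cone 0 n) (\<lambda>A. of_bool ((v, x) \<in> (A \<inter> S \<times> S)\<^sup>*))
      = bexp p (cone 0 L) (\<lambda>A. of_bool ((v, x) \<in> (A \<inter> S \<times> S)\<^sup>*) :: real)" for x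
  proof -
    have "A \<inter> S \<times> S = A \<inter> cone 0 L \<inter> S \<times> S" if "A \<subseteq> cone 0 n" for A using that eq[of S] by blast
    then have "bexp p (cone 0 n) (\<lambda>A. of_bool ((v, x) \<in> (A \<inter> S \<times> S)\<^sup>*))
      = bexp p (cone 0 n) (\<lambda>A. of_bool ((v, x) \<in> (A \<inter> cone 0 L \<inter> S \<times> S)\<^sup>*))"
      by (intro bexp_cong) auto
    also have "\<dots> = bexp p (cone 0 L) (\<lambda>A. of_bool ((v, x) \<in> (A \<inter> S \<times> S)\<^sup>*))"
      by (rule bexp_restrict[OF finite_cone_origin sub])
    finally show ?thesis .
  qed
  moreover have "cone 0 n \<inter> S \<times> - S = cone 0 L \<inter> S \<times> - S" by (rule eq)
  ultimately show ?thesis unfolding exit_sum_def by simp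
qed

lemma connect_prob_step:
  assumes "0 \<le> p" "p \<le> 1" "0 \<in> S" "S \<subseteq> cone_vertices (int L)" "S \<inter> level (int L) = {}" "L \<le> n"
  shows "connect_prob p n \<le> p * exit_sum p (cone 0 (int L)) 0 S * connect_prob p (n - L)"
proof -
  have lt: "snd x < int L" if "x \<in> S" for x
    using that assms(4,5) unfolding cone_vertices_def level_def by fastforce
  have "connect_prob p n \<le> p * exit_sum p (cone 0 (int n)) 0 S * connect_prob p (n - L)"
    unfolding connect_prob_def[of p n]
  proof (rule simon_lieb[OF finite_cone_origin _ assms(3) _ assms(1,2)])
    show "finite S" using assms(4) finite_cone_vertices by (rule finite_subset)
    have "x \<notin> level (int n)" if "x \<in> S" for x
      using lt[OF that] assms(6) by (simp add: level_def)
    then show "S \<inter> level (int n) = {}" by blast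
    fix x y assume xy: "(x, y) \<in> cone 0 (int n)" "x \<in> S" "y \<notin> S"
    have y: "y \<in> cone_vertices (int n)" using subsetD[OF cone_subset_vertices xy(1)] by simp
    have "(x, y) \<in> up_edges" using subsetD[OF cone_subset_up_edges xy(1)] .
    then have ev: "y \<in> even_lattice" and "snd y = snd x + 1"
      by (rule up_edges_even) (use \<open>(x, y) \<in> up_edges\<close> in \<open>auto simp: up_edges_def\<close>)
    \<comment> \<open>The exit edge starts below level \<open>L\<close>, so it ends at height at
      most \<open>L\<close>, and at least \<open>n - L\<close> levels remain.\<close>
    then have "n - L \<le> n - nat (snd y)" using lt[OF xy(2)] by linarith
    then show "bexp p (cone 0 (int n)) (\<lambda>A. of_bool (reach A y (level (int n)))) \<le> connect_prob p (n - L)"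
      by (rule order_trans[OF connect_prob_from[OF assms(1,2) ev y] connect_prob_antimono[OF assms(1,2)]])
  qed
  also have "exit_sum p (cone 0 (int n)) 0 S = exit_sum p (cone 0 (int L)) 0 S"
    using assms(4-6) by (intro exit_sum_cone) auto
  finally show ?thesis .
qed

lemma connect_prob_decay:
  assumes "0 \<le> p" "p \<le> 1" "0 \<in> S" "S \<subseteq> cone_vertices (int L)" "S \<inter> level (int L) = {}"
    and "p * exit_sum p (cone 0 (int L)) 0 S \<le> \<phi>" "0 \<le> \<phi>" "0 < L"
  shows "connect_prob p n \<le> \<phi> ^ (n div L)"
proof (induction n rule: less_induct)
  case (less n)
  show ?case
  proof (cases "n < L")
    case True
    then show ?thesis using connect_prob_le_1[OF assms(1,2)] by simp
  next
    case False
    have "connect_prob p n \<le> p * exit_sum p (cone 0 (int L)) 0 S * connect_prob p (n - L)"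
      using False by (intro connect_prob_step assms) auto
    also have "\<dots> \<le> \<phi> * \<phi> ^ ((n - L) div L)"
      using False assms(8) connect_prob_nonneg[OF assms(1,2)] less.IH[of "n - L"] assms(6,7)
      by (intro mult_mono) auto
    also have "\<dots> = \<phi> ^ (n div L)"
      using False assms(8) by (simp add: le_div_geq)
    finally show ?thesis .
  qed
qed

lemma connect_prob_dichotomy:
  assumes "0 < a" "a < b" "b \<le> 1"
  shows "(\<exists>p L \<phi>. a \<le> p \<and> p \<le> b \<and> 0 < L \<and> 0 < \<phi> \<and> \<phi> < 1 \<and> (\<forall>n. connect_prob p n \<le> \<phi> ^ (n div L)))
    \<or> (\<forall>n. 1 - exp (a - b) \<le> connect_prob b n)"
proof (cases "\<exists>p L S. a \<le> p \<and> p \<le> b \<and> 0 \<in> S \<and> S \<subseteq> cone_vertices (int L) \<and> S \<inter> level (int L) = {}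
      \<and> p * exit_sum p (cone 0 (int L)) 0 S < 1")
  case True
  then obtain p L S where p: "a \<le> p" "p \<le> b" "0 \<in> S" "S \<subseteq> cone_vertices (int L)" "S \<inter> level (int L) = {}"
    and lt: "p * exit_sum p (cone 0 (int L)) 0 S < 1" by blast
  have "L \<noteq> 0" using p(3,5) by (auto simp: level_def)
  \<comment> \<open>The maximum with 1/2 keeps \<phi> strictly positive, since its logarithm is used
    later.\<close>
  define \<phi> where "\<phi> = max (1/2) (p * exit_sum p (cone 0 (int L)) 0 S)"
  have "connect_prob p n \<le> \<phi> ^ (n div L)" for n
    using p assms \<open>L \<noteq> 0\<close> by (intro connect_prob_decay[of p S L]) (auto simp: \<phi>_def)
  moreover have "0 < \<phi>" "\<phi> < 1" using lt by (auto simp: \<phi>_def)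
  ultimately show ?thesis using p \<open>L \<noteq> 0\<close> by blast
next
  case False
  \<comment> \<open>The failure of the first case for every \<open>L\<close> is used here with
    \<open>L = n\<close>.\<close>
  have "1 - exp (a - b) \<le> connect_prob b n" for n
    unfolding connect_prob_def
  proof (rule reach_prob_lower_bound[OF finite_cone_origin finite_cone_vertices _ cone_subset_vertices])
    show "0 \<in> cone_vertices (int n)" by (simp add: cone_vertices_def)
    fix S p
    assume "a \<le> p" "p \<le> b" "0 \<in> S" "S \<subseteq> cone_vertices (int n)" "S \<inter> level (int n) = {}"
    then show "1 \<le> p * exit_sum p (cone 0 (int n)) 0 S" using False not_less by blast
  qed (use assms in auto)
  then show ?thesis by blast
qed

section \<open>Random configurations\<close>

text \<open>In the coupling of \<open>bexp_sprinkle\<close>, the at most \<open>k\<close> elements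
  of \<open>B\<close> missing from \<open>A\<close> are all added with probability at least
  \<open>s ^ k\<close>, and then the increasing property \<open>Q\<close> holds.\<close>

lemma bexp_sprinkle_bound:
  assumes "finite F" "0 \<le> p" "p \<le> 1" "0 \<le> s" "s \<le> 1"
    and mono: "\<And>A B. Q A \<Longrightarrow> A \<subseteq> B \<Longrightarrow> Q B"
  shows "s ^ k * bexp p F (\<lambda>A. of_bool (\<exists>B\<subseteq>F. Q B \<and> card (B - A) \<le> k))
    \<le> bexp (p + (1 - p) * s) F (\<lambda>A. of_bool (Q A))"
  unfolding bexp_sprinkle[OF assms(1)] bexp_cmult[symmetric]
proof (rule bexp_mono[OF assms(2,3)])
  fix A assume "A \<subseteq> F"
  show "s ^ k * of_bool (\<exists>B\<subseteq>F. Q B \<and> card (B - A) \<le> k) \<le> bexp s F (\<lambda>C. of_bool (Q (A \<union> C)))"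
  proof (cases "\<exists>B\<subseteq>F. Q B \<and> card (B - A) \<le> k")
    case True
    then obtain B where B: "B \<subseteq> F" "Q B" "card (B - A) \<le> k" by blast
    have "s ^ k \<le> s ^ card (B - A)" using B(3) assms(4,5) by (rule power_decreasing)
    also have "\<dots> = bexp s F (\<lambda>C. of_bool (B - A \<subseteq> C))"
      using B(1) by (intro bexp_superset[symmetric] assms(1)) auto
    also have "\<dots> \<le> bexp s F (\<lambda>C. of_bool (Q (A \<union> C)))"
    proof (rule bexp_mono[OF assms(4,5)])
      fix C
      have "Q (A \<union> C)" if "B - A \<subseteq> C" using B(2) by (rule mono) (use that in auto)
      then show "of_bool (B - A \<subseteq> C) \<le> (of_bool (Q (A \<union> C)) :: real)" by simp
    qed
    finally show ?thesis using True by simp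
  next
    case False
    then show ?thesis using assms(4,5) by (auto intro!: bexp_nonneg)
  qed
qed

definition open_edges :: "'e set \<Rightarrow> ('e \<Rightarrow> 'a \<Rightarrow> real) \<Rightarrow> 'a \<Rightarrow> 'e set" where
  "open_edges E X \<omega> = {e \<in> E. X e \<omega> = 1}"

text \<open>Records the joint law of the open edges on finite sets only, so that it applies alike to
  the upward edges and to their reflections on any probability space. The almost sure values turn
  sums of costs into counts of open edges.\<close>

definition bernoulli_field :: "'a measure \<Rightarrow> real \<Rightarrow> 'e set \<Rightarrow> ('e \<Rightarrow> 'a \<Rightarrow> real) \<Rightarrow> bool" where
  "bernoulli_field M p E X \<longleftrightarrow> prob_space M \<and>
     (\<forall>e\<in>E. AE \<omega> in M. X e \<omega> \<in> {0, 1}) \<and>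
     (\<forall>F A. finite F \<longrightarrow> F \<subseteq> E \<longrightarrow> A \<subseteq> F \<longrightarrow>
        {\<omega> \<in> space M. open_edges E X \<omega> \<inter> F = A} \<in> sets M \<and>
        measure M {\<omega> \<in> space M. open_edges E X \<omega> \<inter> F = A} = p ^ card A * (1 - p) ^ card (F - A))"

lemma bernoulli_field_prob:
  assumes "bernoulli_field M p E X" "finite F" "F \<subseteq> E"
  shows "{\<omega> \<in> space M. Q (open_edges E X \<omega> \<inter> F)} \<in> sets M"
    and "measure M {\<omega> \<in> space M. Q (open_edges E X \<omega> \<inter> F)} = bexp p F (\<lambda>A. of_bool (Q A))"
proof -
  interpret prob_space M using assms(1) by (simp add: bernoulli_field_def)
  let ?P = "{A \<in> Pow F. Q A}"
  let ?E = "\<lambda>A. {\<omega> \<in> space M. open_edges E X \<omega> \<inter> F = A}"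
  have ev: "?E A \<in> sets M" "measure M (?E A) = p ^ card A * (1 - p) ^ card (F - A)" if "A \<in> ?P" for A
    using assms that unfolding bernoulli_field_def by auto
  have eq: "{\<omega> \<in> space M. Q (open_edges E X \<omega> \<inter> F)} = (\<Union>A\<in>?P. ?E A)" by auto
  have fin: "finite ?P" using assms(2) by auto
  show "{\<omega> \<in> space M. Q (open_edges E X \<omega> \<inter> F)} \<in> sets M"
    unfolding eq using fin ev(1) by (intro sets.finite_UN) auto
  have "measure M {\<omega> \<in> space M. Q (open_edges E X \<omega> \<inter> F)} = (\<Sum>A\<in>?P. measure M (?E A))"
    unfolding eq using fin ev(1)
    by (intro finite_measure_finite_Union) (auto simp: disjoint_family_on_def)
  also have "\<dots> = (\<Sum>A\<in>?P. p ^ card A * (1 - p) ^ card (F - A))"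
    by (intro sum.cong refl ev(2))
  also have "\<dots> = (\<Sum>A\<in>?P. p ^ card A * (1 - p) ^ card (F - A) * of_bool (Q A))"
    by (intro sum.cong) auto
  also have "\<dots> = bexp p F (\<lambda>A. of_bool (Q A))"
    unfolding bexp_def using assms(2) by (intro sum.mono_neutral_left) auto
  finally show "measure M {\<omega> \<in> space M. Q (open_edges E X \<omega> \<inter> F)} = bexp p F (\<lambda>A. of_bool (Q A))" .
qed

section \<open>From independent costs to Bernoulli fields\<close>

lemma measure_bernoulli_cost:
  assumes "0 \<le> p" "p \<le> 1"
  shows "measure (bernoulli_cost p) {1} = p" "measure (bernoulli_cost p) (- {1}) = 1 - p"
    and "AE x in bernoulli_cost p. x \<in> {0, 1}"
proof -
  interpret prob_space "bernoulli_cost p" by (rule prob_space_bernoulli_cost)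
  have sets: "sets (bernoulli_cost p) = sets borel" and space: "space (bernoulli_cost p) = UNIV"
    by (simp_all add: bernoulli_cost_def)
  have "measure (bernoulli_cost p) {1} = measure (measure_pmf (bernoulli_pmf p)) (of_bool -` {1::real})"
    unfolding bernoulli_cost_def by (subst measure_distr) auto
  also have "of_bool -` {1::real} = {True}" by (auto simp: of_bool_def split: if_splits)
  finally show 1: "measure (bernoulli_cost p) {1} = p" using assms by (simp add: measure_pmf_single)
  have "- {1} = space (bernoulli_cost p) - {1::real}" using space by auto
  then show "measure (bernoulli_cost p) (- {1}) = 1 - p"
    using prob_compl[of "{1}"] 1 sets by simp
  show "AE x in bernoulli_cost p. x \<in> {0, 1}"
    unfolding bernoulli_cost_def by (subst AE_distr_iff) (auto intro!: AE_I2)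
qed

lemma bernoulli_field_indep:
  assumes "prob_space M" "prob_space.indep_vars M (\<lambda>_. borel) c I"
    and dist: "\<And>e. e \<in> I \<Longrightarrow> distr M borel (c e) = bernoulli_cost p"
    and p: "0 \<le> p" "p \<le> 1" and g: "inj_on g E" "g ` E \<subseteq> I"
  shows "bernoulli_field M p E (\<lambda>e. c (g e))"
proof -
  interpret prob_space M by fact
  have meas: "c i \<in> borel_measurable M" if "i \<in> I" for i
    using assms(2) that unfolding indep_vars_def by auto
  let ?X = "\<lambda>e. c (g e)"
  have "AE \<omega> in M. ?X e \<omega> \<in> {0, 1}" if "e \<in> E" for e
  proof -
    have i: "g e \<in> I" using that g by auto
    have "AE x in distr M borel (c (g e)). x \<in> {0, 1}"
      unfolding dist[OF i] using measure_bernoulli_cost(3)[OF p] .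
    then show ?thesis by (rule AE_distrD[OF meas[OF i]])
  qed
  moreover have "{\<omega> \<in> space M. open_edges E ?X \<omega> \<inter> F = A} \<in> sets M \<and>
      measure M {\<omega> \<in> space M. open_edges E ?X \<omega> \<inter> F = A} = p ^ card A * (1 - p) ^ card (F - A)"
    if F: "finite F" "F \<subseteq> E" and A: "A \<subseteq> F" for F A
  \<comment> \<open>For empty \<open>F\<close> the intersection formed below would be
    \<open>UNIV\<close> instead of \<open>space M\<close>.\<close>
  proof (cases "F = {}")
    case True
    then have "{\<omega> \<in> space M. open_edges E ?X \<omega> \<inter> F = A} = space M" using A by auto
    then show ?thesis using True A prob_space by simp
  next
    case False
    define B where "B i = (if i \<in> g ` A then {1} else - {1::real})" for i
    have injF: "inj_on g F" using g(1) F(2) inj_on_subset by blast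
    have I: "g ` F \<subseteq> I" using F g by auto
    have B: "B i \<in> sets borel" for i unfolding B_def by auto
    have gA: "g e \<in> g ` A \<longleftrightarrow> e \<in> A" if "e \<in> F" for e
      using that A injF by (auto simp: inj_on_def)
    have eq: "{\<omega> \<in> space M. open_edges E ?X \<omega> \<inter> F = A} = (\<Inter>i\<in>g ` F. c i -` B i \<inter> space M)"
    proof -
      have "open_edges E ?X \<omega> \<inter> F = A \<longleftrightarrow> (\<forall>e\<in>F. c (g e) \<omega> \<in> B (g e))" for \<omega>
      proof -
        have "c (g e) \<omega> \<in> B (g e) \<longleftrightarrow> (e \<in> open_edges E ?X \<omega> \<longleftrightarrow> e \<in> A)" if "e \<in> F" for e
          using gA[OF that] that F(2) by (auto simp: B_def open_edges_def)
        then show ?thesis using A by blast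
      qed
      then show ?thesis using False by auto
    qed
    have pr: "prob (c (g e) -` B (g e) \<inter> space M) = (if e \<in> A then p else 1 - p)" if "e \<in> F" for e
    proof -
      have i: "g e \<in> I" using that I by auto
      have "prob (c (g e) -` B (g e) \<inter> space M) = measure (distr M borel (c (g e))) (B (g e))"
        using meas[OF i] B by (simp add: measure_distr)
      also have "\<dots> = measure (bernoulli_cost p) (B (g e))" by (simp add: dist[OF i])
      finally show ?thesis using gA[OF that] measure_bernoulli_cost[OF p] by (simp add: B_def)
    qed
    have "{\<omega> \<in> space M. open_edges E ?X \<omega> \<inter> F = A} \<in> sets M"
      unfolding eq using False F I meas B
      by (intro sets.finite_INT) (auto intro!: measurable_sets)
    moreover have "prob (\<Inter>i\<in>g ` F. c i -` B i \<inter> space M) = (\<Prod>i\<in>g ` F. prob (c i -` B i \<inter> space M))"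
      using False F I B by (intro indep_varsD[OF assms(2)]) auto
    moreover have "\<dots> = (\<Prod>e\<in>F. if e \<in> A then p else 1 - p)"
      unfolding prod.reindex[OF injF] comp_def by (intro prod.cong refl pr)
    moreover have "\<dots> = p ^ card A * (1 - p) ^ card (F - A)"
    proof -
      have "F \<inter> A = A" "F \<inter> - A = F - A" using A by auto
      then show ?thesis using F(1) by (simp add: prod.If_cases)
    qed
    ultimately show ?thesis unfolding eq by simp
  qed
  ultimately show ?thesis unfolding bernoulli_field_def using assms(1) by auto
qed

text \<open>Two integer squares sum to 2 only if both are 1, so the edges are exactly the diagonal
  unit steps.\<close>

lemma lattice_edge_iff:
  "{u, w} \<in> lattice_edges \<longleftrightarrow> u \<in> even_lattice \<and> w \<in> even_lattice \<and>
     \<bar>fst w - fst u\<bar> = 1 \<and> \<bar>snd w - snd u\<bar> = 1"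
proof -
  have "dist (to_plane u) (to_plane w) = sqrt 2 \<longleftrightarrow> \<bar>fst w - fst u\<bar> = 1 \<and> \<bar>snd w - snd u\<bar> = 1" for u w
  proof -
    let ?a = "fst w - fst u" and ?b = "snd w - snd u"
    have "dist (to_plane u) (to_plane w) = sqrt (of_int (?a\<^sup>2 + ?b\<^sup>2))"
      by (simp add: to_plane_def dist_Pair_Pair dist_real_def power2_commute)
    then have "dist (to_plane u) (to_plane w) = sqrt 2 \<longleftrightarrow> of_int (?a\<^sup>2 + ?b\<^sup>2) = (of_int 2 :: real)"
      by simp
    also have "\<dots> \<longleftrightarrow> ?a\<^sup>2 + ?b\<^sup>2 = 2" by (rule of_int_eq_iff)
    also have "\<dots> \<longleftrightarrow> \<bar>?a\<bar> = 1 \<and> \<bar>?b\<bar> = 1"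
    proof
      assume eq: "?a\<^sup>2 + ?b\<^sup>2 = 2"
      have lt: "\<bar>x\<bar> < 2" if "x\<^sup>2 \<le> 2" for x :: int
        using that power_mono[of 2 "\<bar>x\<bar>" 2] by (cases "\<bar>x\<bar> < 2") auto
      have "\<bar>?a\<bar> < 2" "\<bar>?b\<bar> < 2"
        using eq zero_le_power2[of ?a] zero_le_power2[of ?b] by (intro lt; linarith)+
      then have "?a \<in> {-1, 0, 1}" "?b \<in> {-1, 0, 1}" by auto
      then show "\<bar>?a\<bar> = 1 \<and> \<bar>?b\<bar> = 1" using eq by auto
    next
      assume "\<bar>?a\<bar> = 1 \<and> \<bar>?b\<bar> = 1"
      then have "\<bar>?a\<bar>\<^sup>2 + \<bar>?b\<bar>\<^sup>2 = 2" by simp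
      then show "?a\<^sup>2 + ?b\<^sup>2 = 2" by simp
    qed
    finally show ?thesis .
  qed
  then have edges: "lattice_edges = {{u, w} | u w. u \<in> even_lattice \<and> w \<in> even_lattice \<and>
      \<bar>fst w - fst u\<bar> = 1 \<and> \<bar>snd w - snd u\<bar> = 1}"
    unfolding lattice_edges_def by simp
  show ?thesis
  proof
    assume "{u, w} \<in> lattice_edges"
    then show "u \<in> even_lattice \<and> w \<in> even_lattice \<and> \<bar>fst w - fst u\<bar> = 1 \<and> \<bar>snd w - snd u\<bar> = 1"
      unfolding edges by (auto simp: doubleton_eq_iff)
  qed (use edges in blast)
qed

lemma cost_law_indep:
  shows "prob_space.indep_vars (cost_law p) (\<lambda>_. borel) (\<lambda>e \<omega>. \<omega> e) lattice_edges"
    and "e \<in> lattice_edges \<Longrightarrow> distr (cost_law p) borel (\<lambda>\<omega>. \<omega> e) = bernoulli_cost p"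
proof -
  interpret prob_space "cost_law p" by (rule prob_space_cost_law)
  have [simp]: "sets (bernoulli_cost p) = sets borel" by (simp add: bernoulli_cost_def)
  have dist: "distr (cost_law p) borel (\<lambda>\<omega>. \<omega> e) = bernoulli_cost p" if "e \<in> lattice_edges" for e
  proof -
    have "distr (cost_law p) borel (\<lambda>\<omega>. \<omega> e) = distr (cost_law p) (bernoulli_cost p) (\<lambda>\<omega>. \<omega> e)"
      by (rule distr_cong) auto
    then show ?thesis
      unfolding cost_law_def using that distr_PiM_component prob_space_bernoulli_cost by metis
  qed
  then show "e \<in> lattice_edges \<Longrightarrow> distr (cost_law p) borel (\<lambda>\<omega>. \<omega> e) = bernoulli_cost p" .
  have setsM: "sets (cost_law p) = sets (\<Pi>\<^sub>M e\<in>lattice_edges. (borel :: real measure))"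
    unfolding cost_law_def by (rule sets_PiM_cong) auto
  have rv: "(\<lambda>\<omega>. \<omega> e) \<in> borel_measurable (cost_law p)" if "e \<in> lattice_edges" for e
    unfolding measurable_cong_sets[OF setsM refl] using that by (rule measurable_component_singleton)
  have "{(0, 0), (1, 1)} \<in> lattice_edges"
    unfolding lattice_edge_iff by (simp add: even_lattice_def)
  then have ne: "lattice_edges \<noteq> {}" by blast
  \<comment> \<open>Independence is equivalent to the joint law being the product of the marginals.
    The joint law of the coordinates is \<open>cost_law p\<close> itself, because restriction to
    \<open>lattice_edges\<close> is the identity on extensional functions.\<close>
  have "distr (cost_law p) (\<Pi>\<^sub>M e\<in>lattice_edges. borel) (\<lambda>\<omega>. \<lambda>e\<in>lattice_edges. \<omega> e)
      = distr (cost_law p) (cost_law p) (\<lambda>\<omega>. \<omega>)"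
  proof (rule distr_cong)
    fix \<omega> assume "\<omega> \<in> space (cost_law p)"
    then have "\<omega> \<in> extensional lattice_edges" by (auto simp: cost_law_def space_PiM PiE_def)
    then show "(\<lambda>e\<in>lattice_edges. \<omega> e) = \<omega>" by (rule extensional_restrict)
  qed (use setsM in auto)
  also have "\<dots> = cost_law p" by (rule distr_id2) simp
  also have "\<dots> = (\<Pi>\<^sub>M e\<in>lattice_edges. distr (cost_law p) borel (\<lambda>\<omega>. \<omega> e))"
    unfolding cost_law_def[of p] using dist by (intro PiM_cong) (auto simp: cost_law_def)
  finally show "indep_vars (\<lambda>_. borel) (\<lambda>e \<omega>. \<omega> e) lattice_edges"
    using rv by (subst indep_vars_iff_distr_eq_PiM'[OF ne]) auto
qed

section \<open>Percolation in both directions\<close>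

lemma up_edge_in_lattice: "(u, w) \<in> up_edges \<Longrightarrow> {u, w} \<in> lattice_edges"
  using up_edges_even[of u w] by (auto simp: up_edges_def lattice_edge_iff)

lemma lattice_edge_cases:
  assumes "{u, w} \<in> lattice_edges"
  shows "(u, w) \<in> up_edges \<or> (w, u) \<in> up_edges"
  using assms unfolding lattice_edge_iff up_edges_def by auto

lemma inj_up_edges: "inj_on (\<lambda>(u, w). {u, w}) up_edges"
  by (auto simp: inj_on_def up_edges_def doubleton_eq_iff)

text \<open>Point reflection reverses the direction of an edge, and swapping the endpoints restores
  it. Downward paths from the origin are treated in this way as upward ones.\<close>

definition flip :: "vertex \<times> vertex \<Rightarrow> vertex \<times> vertex" where
  "flip e = (- snd e, - fst e)"

lemma flip_flip [simp]: "flip (flip e) = e"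
  by (simp add: flip_def)

lemma inj_flip: "inj_on flip A"
  by (metis flip_flip inj_onI)

lemma flip_up_edges: "e \<in> up_edges \<Longrightarrow> flip e \<in> up_edges"
  using up_edges_even[of "fst e" "snd e"]
  by (cases e) (auto simp: flip_def up_edges_def even_lattice_def)

lemma flip_image_up_edges: "flip ` up_edges = up_edges"
  using flip_up_edges flip_flip by (metis image_eqI image_subsetI subsetI subset_antisym)

text \<open>Koenig's lemma: a vertex that reaches infinitely many levels has a successor with the
  same property, because it has at most two successors.\<close>

lemma infinite_up_path:
  assumes A: "A \<subseteq> up_edges" and r: "\<And>n. reach A v (level (int n))"
  shows "\<exists>x :: nat \<Rightarrow> vertex. x 0 = v \<and> (\<forall>i. (x i, x (Suc i)) \<in> A)"
proof -
  define good where "good u \<longleftrightarrow> infinite {n. reach A u (level (int n))}" for u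
  have "\<exists>w. good w \<and> (u, w) \<in> A" if "good u" for u
  proof (rule ccontr)
    assume no: "\<not> ?thesis"
    define W where "W = {(fst u + 1, snd u + 1), (fst u - 1, snd u + 1)} \<inter> {w. (u, w) \<in> A}"
    \<comment> \<open>The first set accounts for the empty path, which reaches only the level of
      \<open>u\<close>.\<close>
    have "{n. reach A u (level (int n))} \<subseteq> {..nat (snd u)} \<union> (\<Union>w\<in>W. {n. reach A w (level (int n))})"
    proof
      fix n assume "n \<in> {n. reach A u (level (int n))}"
      then obtain t where t: "(u, t) \<in> A\<^sup>*" "snd t = int n" by (auto simp: reach_def level_def)
      from t(1) show "n \<in> {..nat (snd u)} \<union> (\<Union>w\<in>W. {n. reach A w (level (int n))})"
      proof (cases rule: converse_rtranclE)
        case base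
        then show ?thesis using t(2) by auto
      next
        case (step w)
        then have "(u, w) \<in> up_edges" using A by auto
        then have "w \<in> {(fst u + 1, snd u + 1), (fst u - 1, snd u + 1)}"
          by (cases w) (auto simp: up_edges_def)
        then have "w \<in> W" using step by (simp add: W_def)
        moreover have "reach A w (level (int n))"
          using step(2) t(2) unfolding reach_def level_def by blast
        ultimately show ?thesis by blast
      qed
    qed
    moreover have "finite ({..nat (snd u)} \<union> (\<Union>w\<in>W. {n. reach A w (level (int n))}))"
      using no unfolding W_def good_def by auto
    ultimately show False using that finite_subset unfolding good_def by blast
  qed
  moreover have "good v" using r unfolding good_def by simp
  ultimately obtain x where "x 0 = v" "\<And>i. (x i, x (Suc i)) \<in> A"
    \<comment> \<open>The clause for \<open>n = 0\<close> pins the starting point of the chosen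
      sequence to \<open>v\<close>.\<close>
    using dependent_nat_choice[of "\<lambda>n u. good u \<and> (n = 0 \<longrightarrow> u = v)" "\<lambda>n u w. (u, w) \<in> A"]
    by blast
  then show ?thesis by blast
qed

lemma doubly_infinite_path:
  fixes c :: "edge \<Rightarrow> real"
  assumes A: "A \<subseteq> up_edges" "\<And>u w. (u, w) \<in> A \<Longrightarrow> c {u, w} = 1"
    and up: "\<And>n. reach A 0 (level (int n))" and down: "\<And>n. reach (flip ` A) 0 (level (int n))"
  shows "has_infinite_vertical_open_path c"
proof -
  obtain x :: "nat \<Rightarrow> vertex" where x: "x 0 = 0" "\<And>i. (x i, x (Suc i)) \<in> A"
    using infinite_up_path[OF A(1) up] by blast
  have "flip ` A \<subseteq> up_edges" using A(1) flip_up_edges by blast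
  then obtain y :: "nat \<Rightarrow> vertex" where y: "y 0 = 0" "\<And>i. (y i, y (Suc i)) \<in> flip ` A"
    using infinite_up_path[OF _ down] by blast
  have y': "(- y (Suc i), - y i) \<in> A" for i
  proof -
    obtain e where "e \<in> A" "(y i, y (Suc i)) = flip e" using y(2)[of i] by blast
    then show ?thesis by (cases e) (simp add: flip_def)
  qed
  \<comment> \<open>The negative half is the path of the reflected configuration, reflected back and
    read backwards; both halves are at the origin at index 0.\<close>
  define z where "z i = (if 0 \<le> i then x (nat i) else - y (nat (- i)))" for i :: int
  have z: "(z i, z (i + 1)) \<in> A" for i
  proof (cases "0 \<le> i")
    case True
    then have "nat (i + 1) = Suc (nat i)" by simp
    then show ?thesis using True x(2)[of "nat i"] by (simp add: z_def)
  next
    case False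
    define k where "k = nat (- i - 1)"
    have k: "nat (- i) = Suc k" using False by (simp add: k_def)
    have "z (i + 1) = - y k"
    proof (cases "i = - 1")
      case True
      then show ?thesis using x(1) y(1) by (simp add: z_def k_def)
    next
      case neq: False
      have "nat (- (i + 1)) = k" by (simp add: k_def)
      then show ?thesis using False neq by (simp add: z_def)
    qed
    moreover have "z i = - y (Suc k)" using False k by (simp add: z_def)
    ultimately show ?thesis using y' by simp
  qed
  have up: "(z i, z (i + 1)) \<in> up_edges" for i using z A(1) by blast
  have "lattice_path z"
    unfolding lattice_path_def using up up_edge_in_lattice by (auto simp: up_edges_def)
  moreover have "snd (z i) \<le> snd (z j)" if "i \<le> j" for i j
    using that
  proof (induction j rule: int_ge_induct)
    case (step j)
    then show ?case using up[of j] by (auto simp: up_edges_def)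
  qed simp
  then have "vertical z" unfolding vertical_def mono_def by blast
  moreover have "open_path c z" unfolding open_path_def using A(2) z by blast
  ultimately show ?thesis unfolding has_infinite_vertical_open_path_def by blast
qed

text \<open>The connections from the origin up to level \<open>n\<close> and down to level
  \<open>-n\<close> use disjoint edges, so both occur with probability at least \<eta> squared.
  These events decrease in \<open>n\<close>; by continuity from above their intersection has
  positive probability, and on it \<open>doubly_infinite_path\<close> applies.\<close>

lemma connect_prob_positive_imp_percolation:
  assumes p: "0 \<le> p" "p \<le> 1" and eta: "0 < \<eta>" "\<And>n. \<eta> \<le> connect_prob p n"
  shows "\<not> (AE c in cost_law p. \<not> has_infinite_vertical_open_path c)"
proof
  assume no: "AE c in cost_law p. \<not> has_infinite_vertical_open_path c"
  interpret prob_space "cost_law p" by (rule prob_space_cost_law)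
  define R where "R = open_edges up_edges (\<lambda>e c. (c ((\<lambda>(u, w). {u, w}) e) :: real))"
  have "(\<lambda>(u, w). {u, w}) ` up_edges \<subseteq> lattice_edges" using up_edge_in_lattice by auto
  then have field: "bernoulli_field (cost_law p) p up_edges (\<lambda>e c. c ((\<lambda>(u, w). {u, w}) e))"
    using bernoulli_field_indep[OF prob_space_cost_law cost_law_indep p inj_up_edges] by simp
  have R: "R c \<subseteq> up_edges" for c unfolding R_def open_edges_def by auto
  define P where "P n A \<longleftrightarrow> reach (A \<inter> cone 0 (int n)) 0 (level (int n))" for n A
  have P_antimono: "P m A" if "P n A" "m \<le> n" "A \<subseteq> up_edges" for m n A
  proof -
    have "reach A 0 (level (int n))" using that(1) unfolding P_def by (rule reach_mono) auto
    then show ?thesis using reach_level_in_cone[OF that(3), of 0 "int m" "int n"] that(2)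
      unfolding P_def by simp
  qed
  define G where "G n = {c \<in> space (cost_law p). P n (R c) \<and> P n (flip ` R c)}" for n
  have G: "G n \<in> sets (cost_law p)" "\<eta>\<^sup>2 \<le> prob (G n)" for n
  proof -
    let ?F = "cone 0 (int n)" let ?F' = "flip ` ?F"
    have fin: "finite ?F" "finite ?F'" using finite_cone_origin by auto
    have sub: "?F \<union> ?F' \<subseteq> up_edges" using cone_subset_up_edges flip_up_edges by blast
    \<comment> \<open>Edges of the cone start at height at least 0, reflected ones end at height at
      most 0.\<close>
    have disj: "?F \<inter> ?F' = {}"
      by (auto simp: cone_def flip_def up_edges_def)
    \<comment> \<open>This shows that the downward event depends only on the edges of the reflected
      cone.\<close>
    have eq: "flip ` A \<inter> ?F = flip ` (A \<inter> ?F')" for A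
      by (simp add: image_Int[OF inj_flip] image_image)
    define Q where "Q A \<longleftrightarrow> P n A \<and> P n (flip ` A)" for A
    have QO: "Q A \<longleftrightarrow> Q (A \<inter> (?F \<union> ?F'))" for A
    proof -
      have "A \<inter> (?F \<union> ?F') \<inter> ?F = A \<inter> ?F" "A \<inter> (?F \<union> ?F') \<inter> ?F' = A \<inter> ?F'" by auto
      then show ?thesis unfolding Q_def P_def eq by simp
    qed
    have G_eq: "G n = {c \<in> space (cost_law p). Q (R c \<inter> (?F \<union> ?F'))}"
      unfolding G_def QO[symmetric] unfolding Q_def ..
    show "G n \<in> sets (cost_law p)"
      unfolding G_eq R_def using fin sub by (intro bernoulli_field_prob[OF field]) auto
    have "prob (G n) = bexp p (?F \<union> ?F') (\<lambda>A. of_bool (Q A))"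
      unfolding G_eq R_def using fin sub by (intro bernoulli_field_prob[OF field]) auto
    also have "\<dots> = bexp p (?F \<union> ?F') (\<lambda>A. of_bool (P n A) * of_bool (P n (flip ` A)))"
      by (intro bexp_cong) (simp add: Q_def of_bool_conj)
    also have "\<dots> = bexp p (?F \<union> ?F') (\<lambda>A. of_bool (P n A)) * bexp p (?F \<union> ?F') (\<lambda>A. of_bool (P n (flip ` A)))"
    proof (rule bexp_indep[where G = "?F" and H = "?F'"])
      fix A
      show "of_bool (P n (A \<inter> ?F)) = of_bool (P n A)"
        by (simp add: P_def Int_assoc)
      have "A \<inter> ?F' \<inter> ?F' = A \<inter> ?F'" by auto
      then show "of_bool (P n (flip ` (A \<inter> ?F'))) = of_bool (P n (flip ` A))"
        unfolding P_def eq by simp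
    qed (use fin disj in auto)
    also have "bexp p (?F \<union> ?F') (\<lambda>A. of_bool (P n A)) = connect_prob p n"
      unfolding P_def connect_prob_def
      using bexp_restrict[of "?F \<union> ?F'" ?F p "\<lambda>A. of_bool (reach A 0 (level (int n)))"] fin by simp
    also have "bexp p (?F \<union> ?F') (\<lambda>A. of_bool (P n (flip ` A))) = connect_prob p n"
    proof -
      let ?g = "\<lambda>A. of_bool (reach (flip ` A) 0 (level (int n)))"
      have "bexp p (?F \<union> ?F') (\<lambda>A. of_bool (P n (flip ` A))) = bexp p (?F \<union> ?F') (\<lambda>A. ?g (A \<inter> ?F'))"
        unfolding P_def eq ..
      also have "\<dots> = bexp p ?F' ?g" using fin by (intro bexp_restrict[of _ _ _ ?g]) auto
      also have "\<dots> = bexp p ?F (\<lambda>A. ?g (flip ` A))" by (rule bexp_image[OF fin(1) inj_flip])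
      also have "\<dots> = connect_prob p n" by (simp add: image_image connect_prob_def)
      finally show ?thesis .
    qed
    finally have "prob (G n) = (connect_prob p n)\<^sup>2" by (simp add: power2_eq_square)
    then show "\<eta>\<^sup>2 \<le> prob (G n)" using eta by (simp add: power_mono)
  qed
  have "decseq G"
    unfolding decseq_def G_def using P_antimono R flip_up_edges by blast
  then have "(\<lambda>n. prob (G n)) \<longlonglongrightarrow> prob (\<Inter>n. G n)"
    using G(1) by (intro finite_Lim_measure_decseq) auto
  then have "\<eta>\<^sup>2 \<le> prob (\<Inter>n. G n)" using G(2) by (intro LIMSEQ_le_const) auto
  then have pos: "0 < prob (\<Inter>n. G n)" using eta(1) zero_less_power[of \<eta> 2] by linarith
  have "has_infinite_vertical_open_path c" if "c \<in> (\<Inter>n. G n)" for c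
  proof (rule doubly_infinite_path[OF R[of c]])
    show "c {u, w} = 1" if "(u, w) \<in> R c" for u w
      using that by (simp add: R_def open_edges_def)
    fix n
    have "P n (R c)" "P n (flip ` R c)" using that by (auto simp: G_def)
    then show "reach (R c) 0 (level (int n))" "reach (flip ` R c) 0 (level (int n))"
      unfolding P_def by (auto elim: reach_mono)
  qed
  then have "AE c in cost_law p. c \<notin> (\<Inter>n. G n)" using no by (auto elim!: eventually_mono)
  moreover have "(\<Inter>n. G n) \<in> events" using G(1) by (intro sets.countable_INT) auto
  ultimately have "prob (\<Inter>n. G n) = 0" using prob_eq_0 by blast
  then show False using pos by simp
qed

section \<open>Closed edges along long paths\<close>

text \<open>A path is represented by any edge set \<open>B\<close> connecting the origin to level
  \<open>n\<close>. Quantifying over \<open>B\<close> inside the almost sure statement makes the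
  bound uniform over all paths.\<close>

lemma eventually_many_closed_edges:
  assumes field: "bernoulli_field M p up_edges X" and p: "0 \<le> p" "p < q" "q < 1"
    and decay: "\<And>n. connect_prob q n \<le> \<phi> ^ (n div L)" and L: "0 < L" and \<phi>: "0 < \<phi>" "\<phi> < 1"
  shows "\<exists>\<delta>>0. AE \<omega> in M. \<forall>\<^sub>F n in sequentially.
    \<forall>B\<subseteq>cone 0 (int n). reach B 0 (level (int n)) \<longrightarrow> \<delta> * real n < card (B - open_edges up_edges X \<omega>)"
proof -
  interpret prob_space M using field by (simp add: bernoulli_field_def)
  \<comment> \<open>Adding edges with probability \<open>s\<close> raises the density from
    \<open>p\<close> to \<open>q\<close>.\<close>
  define s where "s = (q - p) / (1 - p)"
  have s: "0 < s" "s < 1" and q: "q = p + (1 - p) * s" using p by (auto simp: s_def field_simps)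
  \<comment> \<open>Chosen so that \<open>s\<close> to the power \<delta>n equals \<phi> to the
    power n/(2L): the price of opening \<delta>n closed edges uses up half of the exponential decay
    at \<open>q\<close>.\<close>
  define \<delta> where "\<delta> = ln \<phi> / (2 * L * ln s)"
  have neg: "ln \<phi> < 0" "ln s < 0" using \<phi> s by auto
  have \<delta>: "0 < \<delta>" using neg L by (simp add: \<delta>_def divide_neg_neg mult_pos_neg)
  have \<delta>_s: "\<delta> * ln s = ln \<phi> / (2 * L)" using neg L by (simp add: \<delta>_def)
  define R where "R = open_edges up_edges X"
  let ?Q = "\<lambda>B n. reach B 0 (level (int n))"
  define bad where "bad n A \<longleftrightarrow> (\<exists>B\<subseteq>cone 0 (int n). ?Q B n \<and> card (B - A) \<le> nat \<lfloor>\<delta> * n\<rfloor>)" for n A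
  define W where "W n = {\<omega> \<in> space M. bad n (R \<omega> \<inter> cone 0 (int n))}" for n
  have W_sets: "W n \<in> sets M" for n
    unfolding W_def R_def
    by (intro bernoulli_field_prob[OF field] finite_cone_origin cone_subset_up_edges)
  \<comment> \<open>The second factor is the remaining half of the decay. The constant factor, equal
    to 1/\<phi>, pays for rounding \<open>n / L\<close> down to \<open>n div L\<close>.\<close>
  have W_prob: "prob (W n) \<le> exp (- ln \<phi>) * exp (ln \<phi> / (2 * L)) ^ n" for n
  proof -
    define k where "k = nat \<lfloor>\<delta> * n\<rfloor>"
    have k: "real k \<le> \<delta> * n" unfolding k_def using \<delta> by (simp add: of_nat_floor)
    have "prob (W n) = bexp p (cone 0 (int n)) (\<lambda>A. of_bool (bad n A))"
      unfolding W_def R_def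
      by (intro bernoulli_field_prob[OF field] finite_cone_origin cone_subset_up_edges)
    then have "s ^ k * prob (W n) \<le> connect_prob q n"
      unfolding connect_prob_def q bad_def k_def using p s reach_mono
      by (simp only:) (rule bexp_sprinkle_bound[OF finite_cone_origin], auto)
    also have "\<dots> \<le> \<phi> ^ (n div L)" by (rule decay)
    also have "\<dots> = exp (real (n div L) * ln \<phi>)" using \<phi> by (simp add: exp_of_nat_mult)
    also have "\<dots> \<le> exp ((n / L - 1) * ln \<phi>)"
    proof -
      have "real n / real L \<le> real (n div L) + 1"
      proof -
        have "real n < real (L + n div L * L)"
          using dividend_less_div_times[OF L, of n] by (rule of_nat_less_iff[THEN iffD2])
        then show ?thesis using L by (simp add: field_simps)
      qed
      then show ?thesis using neg(1) by (simp add: mult_right_mono_neg)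
    qed
    finally have le: "s ^ k * prob (W n) \<le> exp ((n / L - 1) * ln \<phi>)" .
    have "exp (\<delta> * n * ln s) \<le> exp (real k * ln s)"
      using k neg(2) by (simp add: mult_right_mono_neg)
    also have "\<dots> = s ^ k" using s by (simp add: exp_of_nat_mult)
    finally have "exp (\<delta> * n * ln s) * prob (W n) \<le> s ^ k * prob (W n)"
      by (intro mult_right_mono) auto
    then have "exp (- (\<delta> * n * ln s)) * (exp (\<delta> * n * ln s) * prob (W n))
        \<le> exp (- (\<delta> * n * ln s)) * exp ((n / L - 1) * ln \<phi>)"
      using le by (intro mult_left_mono) auto
    then have "prob (W n) \<le> exp (- (\<delta> * n * ln s) + (n / L - 1) * ln \<phi>)"
      by (simp add: mult.assoc[symmetric] exp_add[symmetric])
    also have "- (\<delta> * n * ln s) + (n / L - 1) * ln \<phi> = - ln \<phi> + n * (ln \<phi> / (2 * L))"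
    proof -
      have "\<delta> * n * ln s = n * (\<delta> * ln s)" by simp
      also have "\<dots> = n * (ln \<phi> / (2 * L))" unfolding \<delta>_s ..
      finally have eq: "\<delta> * n * ln s = n * (ln \<phi> / (2 * L))" .
      show ?thesis unfolding eq using L by (simp add: field_simps)
    qed
    finally show ?thesis unfolding exp_add exp_of_nat_mult .
  qed
  have "summable (\<lambda>n. exp (- ln \<phi>) * exp (ln \<phi> / (2 * L)) ^ n)"
    using neg(1) L by (intro summable_mult summable_geometric) (simp add: divide_neg_pos)
  then have "summable (\<lambda>n. prob (W n))"
    by (rule summable_comparison_test'[where N = 0]) (use W_prob in simp)
  then have "AE \<omega> in M. \<forall>\<^sub>F n in sequentially. \<omega> \<in> space M - W n"
    using W_sets by (intro borel_cantelli_AE1) (auto simp: less_top[symmetric])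
  then have "AE \<omega> in M. \<forall>\<^sub>F n in sequentially.
    \<forall>B\<subseteq>cone 0 (int n). ?Q B n \<longrightarrow> \<delta> * real n < card (B - R \<omega>)"
  proof (rule eventually_mono, elim eventually_mono)
    fix \<omega> n assume \<omega>: "\<omega> \<in> space M - W n"
    show "\<forall>B\<subseteq>cone 0 (int n). ?Q B n \<longrightarrow> \<delta> * real n < card (B - R \<omega>)"
    proof (intro allI impI)
      fix B assume B: "B \<subseteq> cone 0 (int n)" "?Q B n"
      have "\<not> bad n (R \<omega> \<inter> cone 0 (int n))" using \<omega> unfolding W_def by simp
      then have "\<not> card (B - R \<omega> \<inter> cone 0 (int n)) \<le> nat \<lfloor>\<delta> * n\<rfloor>"
        using B unfolding bad_def by blast
      moreover have "B - R \<omega> \<inter> cone 0 (int n) = B - R \<omega>" using B(1) by auto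
      ultimately have "nat \<lfloor>\<delta> * n\<rfloor> < card (B - R \<omega>)" by simp
      then show "\<delta> * real n < card (B - R \<omega>)" by linarith
    qed
  qed
  then show ?thesis using \<delta> unfolding R_def by blast
qed

text \<open>The first \<open>n\<close> edges of an upward path are distinct, as their starting
  points have different heights. Their total cost is therefore \<open>n\<close> minus the number of
  closed edges among them.\<close>

lemma up_path_average:
  assumes x: "x 0 = 0" "\<And>i. (x i, x (Suc i)) \<in> up_edges"
    and X: "\<And>e. e \<in> up_edges \<Longrightarrow> X e \<omega> \<in> {0, 1}"
    and n: "\<forall>B\<subseteq>cone 0 (int n). reach B 0 (level (int n)) \<longrightarrow> \<delta> * real n < card (B - open_edges up_edges X \<omega>)"
    and "0 < n"
  shows "1 / real n * (\<Sum>m=1..n. X (x (m - 1), x m) \<omega>) \<le> 1 - \<delta>"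
proof -
  let ?R = "open_edges up_edges X \<omega>"
  define B where "B = (\<lambda>i. (x i, x (Suc i))) ` {..<n}"
  have snd_x: "snd (x i) = int i" for i
    by (induction i) (use x in \<open>auto simp: up_edges_def\<close>)
  have fst_x: "\<bar>fst (x i)\<bar> \<le> int i" for i
  proof (induction i)
    case (Suc i)
    then show ?case using x(2)[of i] by (auto simp: up_edges_def)
  qed (simp add: x(1))
  have inj: "inj_on (\<lambda>i. (x i, x (Suc i))) {..<n}"
    by (rule inj_onI) (metis fst_conv of_nat_eq_iff snd_x)
  have "B \<subseteq> cone 0 (int n)"
    using x(2) fst_x snd_x by (auto simp: B_def cone_def)
  moreover have "(0, x i) \<in> B\<^sup>*" if "i \<le> n" for i
    using that
  proof (induction i)
    case (Suc i)
    then have "(x i, x (Suc i)) \<in> B" by (auto simp: B_def)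
    then show ?case using Suc by (auto intro: rtrancl_into_rtrancl)
  qed (simp add: x(1))
  then have "reach B 0 (level (int n))" using snd_x unfolding reach_def level_def by blast
  ultimately have closed: "\<delta> * real n < card (B - ?R)" using n by blast
  have fin: "finite B" by (simp add: B_def)
  have Bup: "B \<subseteq> up_edges" using x(2) by (auto simp: B_def)
  have "(\<Sum>m=1..n. X (x (m - 1), x m) \<omega>) = (\<Sum>i<n. X (x i, x (Suc i)) \<omega>)"
    by (rule sum.reindex_bij_witness[of _ Suc "\<lambda>m. m - 1"]) auto
  also have "\<dots> = (\<Sum>e\<in>B. X e \<omega>)" unfolding B_def by (simp add: sum.reindex[OF inj])
  also have "\<dots> = (\<Sum>e\<in>B. of_bool (e \<in> ?R))"
  proof (rule sum.cong)
    fix e assume "e \<in> B"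
    then have "e \<in> up_edges" using Bup by blast
    then show "X e \<omega> = of_bool (e \<in> ?R)" using X[of e] by (auto simp: open_edges_def)
  qed simp
  also have "\<dots> = card (B \<inter> ?R)" using fin by simp
  also have "\<dots> = real n - card (B - ?R)"
  proof -
    have "card B = card (B \<inter> ?R) + card (B - ?R)" using fin by (rule card_Int_Diff)
    moreover have "card B = n" unfolding B_def using inj by (simp add: card_image)
    ultimately show ?thesis by simp
  qed
  finally have "(\<Sum>m=1..n. X (x (m - 1), x m) \<omega>) \<le> (1 - \<delta>) * n" using closed by (simp add: algebra_simps)
  then show ?thesis using \<open>0 < n\<close> by (simp add: field_simps)
qed

lemma up_path_limsup:
  assumes field: "bernoulli_field M p up_edges X" and p: "0 \<le> p" "p < q" "q < 1"
    and decay: "\<And>n. connect_prob q n \<le> \<phi> ^ (n div L)" and L: "0 < L" and \<phi>: "0 < \<phi>" "\<phi> < 1"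
  shows "\<exists>\<delta>>0. AE \<omega> in M. \<forall>x. x 0 = 0 \<and> (\<forall>i. (x i, x (Suc i)) \<in> up_edges) \<longrightarrow>
    limsup (\<lambda>n. ereal (1 / real n * (\<Sum>m=1..n. X (x (m - 1), x m) \<omega>))) \<le> ereal (1 - \<delta>)"
proof -
  obtain \<delta> where "\<delta> > 0" and ev: "AE \<omega> in M. \<forall>\<^sub>F n in sequentially.
    \<forall>B\<subseteq>cone 0 (int n). reach B 0 (level (int n)) \<longrightarrow> \<delta> * real n < card (B - open_edges up_edges X \<omega>)"
    using eventually_many_closed_edges[OF assms] by blast
  \<comment> \<open>There are countably many edges, so a single null set serves for all of
    them.\<close>
  have "AE \<omega> in M. \<forall>e\<in>up_edges. X e \<omega> \<in> {0, 1}"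
    using field unfolding bernoulli_field_def by (subst AE_ball_countable) auto
  with ev have "AE \<omega> in M. \<forall>x. x 0 = 0 \<and> (\<forall>i. (x i, x (Suc i)) \<in> up_edges) \<longrightarrow>
    limsup (\<lambda>n. ereal (1 / real n * (\<Sum>m=1..n. X (x (m - 1), x m) \<omega>))) \<le> ereal (1 - \<delta>)"
  proof eventually_elim
    case (elim \<omega>)
    show ?case
    proof (intro allI impI)
      fix x :: "nat \<Rightarrow> vertex" assume x: "x 0 = 0 \<and> (\<forall>i. (x i, x (Suc i)) \<in> up_edges)"
      have "\<forall>\<^sub>F n in sequentially. 1 / real n * (\<Sum>m=1..n. X (x (m - 1), x m) \<omega>) \<le> 1 - \<delta>"
        using elim(1) eventually_gt_at_top[of 0]
      proof eventually_elim
        case (elim n)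
        then show ?case using x \<open>\<forall>e\<in>up_edges. X e \<omega> \<in> {0, 1}\<close> by (intro up_path_average) auto
      qed
      then show "limsup (\<lambda>n. ereal (1 / real n * (\<Sum>m=1..n. X (x (m - 1), x m) \<omega>))) \<le> ereal (1 - \<delta>)"
        by (intro Limsup_bounded) (simp add: eventually_mono)
    qed
  qed
  then show ?thesis using \<open>\<delta> > 0\<close> by blast
qed

section \<open>Reduction to upward paths and conclusion\<close>

lemma vertical_path_cases:
  assumes "P \<in> semi_infinite_vertical_paths_from_origin"
  shows "P 0 = 0" and "(\<forall>i. (P i, P (Suc i)) \<in> up_edges) \<or> (\<forall>i. (P (Suc i), P i) \<in> up_edges)"
proof -
  have P: "P 0 = (0, 0)" "\<And>i. {P i, P (Suc i)} \<in> lattice_edges"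
    "mono (\<lambda>i. snd (P i)) \<or> antimono (\<lambda>i. snd (P i))"
    using assms unfolding semi_infinite_vertical_paths_from_origin_def lattice_path_def vertical_def
    by auto
  show "P 0 = 0" using P(1) by (simp add: zero_prod_def)
  \<comment> \<open>Every edge changes the height by exactly one, so monotonicity in either sense
    excludes one direction at all indices at once.\<close>
  have step: "(P i, P (Suc i)) \<in> up_edges \<or> (P (Suc i), P i) \<in> up_edges" for i
    using lattice_edge_cases[OF P(2)] .
  from P(3) show "(\<forall>i. (P i, P (Suc i)) \<in> up_edges) \<or> (\<forall>i. (P (Suc i), P i) \<in> up_edges)"
  proof
    assume "mono (\<lambda>i. snd (P i))"
    then have "snd (P i) \<le> snd (P (Suc i))" for i by (simp add: mono_def)
    then have "snd (P i) \<noteq> snd (P (Suc i)) + 1" for i by (smt (verit))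
    then have "(P (Suc i), P i) \<notin> up_edges" for i by (simp add: up_edges_def)
    then show ?thesis using step by blast
  next
    assume "antimono (\<lambda>i. snd (P i))"
    then have "snd (P (Suc i)) \<le> snd (P i)" for i by (simp add: antimono_def)
    then have "snd (P (Suc i)) \<noteq> snd (P i) + 1" for i by (smt (verit))
    then have "(P i, P (Suc i)) \<notin> up_edges" for i by (simp add: up_edges_def)
    then show ?thesis using step by blast
  qed
qed

text \<open>Since \<open>b\<close> lies below \<open>pc\<close>, the percolating alternative of the
  dichotomy is excluded by \<open>connect_prob_positive_imp_percolation\<close>. Taking
  \<open>a\<close> strictly above \<open>p\<close> leaves room for sprinkling from \<open>p\<close>
  to \<open>q\<close>.\<close>

lemma subcritical_decay:
  assumes "is_critical_parameter pc" "0 \<le> p" "p < pc"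
  shows "\<exists>q L \<phi>. p < q \<and> q < 1 \<and> 0 < L \<and> 0 < \<phi> \<and> \<phi> < 1 \<and> (\<forall>n. connect_prob q n \<le> \<phi> ^ (n div L))"
proof -
  obtain a where a: "p < a" "a < pc" using dense[OF assms(3)] by blast
  obtain b where b: "a < b" "b < pc" using dense[OF a(2)] by blast
  have pc: "pc < 1" using assms(1) by (simp add: is_critical_parameter_def)
  have "AE c in cost_law b. \<not> has_infinite_vertical_open_path c"
    using assms(1,2) a b unfolding is_critical_parameter_def by auto
  then have "\<not> (\<forall>n. 1 - exp (a - b) \<le> connect_prob b n)"
    using connect_prob_positive_imp_percolation[of b "1 - exp (a - b)"] assms(2) a b pc by auto
  moreover have "0 < a" "b \<le> 1" using assms(2) a b pc by auto
  ultimately obtain q L \<phi> where "a \<le> q" "q \<le> b" "0 < L" "0 < \<phi>" "\<phi> < 1" "\<forall>n. connect_prob q n \<le> \<phi> ^ (n div L)"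
    using connect_prob_dichotomy[OF _ b(1)] by blast
  moreover from this have "p < q" "q < 1" using a b pc by auto
  ultimately show ?thesis by blast
qed

theorem claim5p2:
  fixes M :: "'a measure" and c :: "edge \<Rightarrow> 'a \<Rightarrow> real" and p pc :: real
  assumes "is_critical_parameter pc"
    and "0 \<le> p" and "p < pc"
    and "prob_space M"
    and "prob_space.indep_vars M (\<lambda>_. borel) c lattice_edges"
    and "\<And>e. e \<in> lattice_edges \<Longrightarrow> distr M borel (c e) = bernoulli_cost p"
  shows "\<exists>\<delta>>0. AE \<omega> in M.
           (SUP P \<in> semi_infinite_vertical_paths_from_origin.
              limsup (\<lambda>n. ereal (1 / real n * (\<Sum>m = 1..n. c {P (m - 1), P m} \<omega>))))
           < ereal (1 - \<delta>)"
proof -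
  obtain q L \<phi> where q: "p < q" "q < 1" "0 < L" "0 < \<phi>" "\<phi> < 1"
    and decay: "\<And>n. connect_prob q n \<le> \<phi> ^ (n div L)"
    using subcritical_decay[OF assms(1-3)] by blast
  let ?g = "\<lambda>(u, w). {u, w} :: edge"
  let ?lim = "\<lambda>P \<omega>. limsup (\<lambda>n. ereal (1 / real n * (\<Sum>m = 1..n. c {P (m - 1), P m} \<omega>)))"
  let ?up = "\<lambda>x. x 0 = 0 \<and> (\<forall>i. (x i, x (Suc i)) \<in> up_edges)"
  have p1: "p \<le> 1" using q by simp
  have g: "?g ` up_edges \<subseteq> lattice_edges" using up_edge_in_lattice by auto
  have up: "bernoulli_field M p up_edges (\<lambda>e. c (?g e))"
    by (rule bernoulli_field_indep[OF assms(4-6) assms(2) p1 inj_up_edges g])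
  have inj': "inj_on (?g \<circ> flip) up_edges"
    using inj_up_edges inj_flip by (intro comp_inj_on) (simp_all add: flip_image_up_edges)
  have g': "(?g \<circ> flip) ` up_edges \<subseteq> lattice_edges"
    using g by (simp only: image_comp[symmetric] flip_image_up_edges)
  \<comment> \<open>The reflection permutes \<open>up_edges\<close>, so the reflected costs form a
    Bernoulli field with the same parameter.\<close>
  have down: "bernoulli_field M p up_edges (\<lambda>e. c ((?g \<circ> flip) e))"
    by (rule bernoulli_field_indep[OF assms(4-6) assms(2) p1 inj' g'])
  obtain d1 where d1: "d1 > 0" "AE \<omega> in M. \<forall>x. ?up x \<longrightarrow>
      limsup (\<lambda>n. ereal (1 / real n * (\<Sum>m=1..n. c (?g (x (m - 1), x m)) \<omega>))) \<le> ereal (1 - d1)"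
    using up_path_limsup[OF up assms(2) q(1,2) decay q(3-5)] by blast
  obtain d2 where d2: "d2 > 0" "AE \<omega> in M. \<forall>x. ?up x \<longrightarrow>
      limsup (\<lambda>n. ereal (1 / real n * (\<Sum>m=1..n. c ((?g \<circ> flip) (x (m - 1), x m)) \<omega>))) \<le> ereal (1 - d2)"
    using up_path_limsup[OF down assms(2) q(1,2) decay q(3-5)] by blast
  \<comment> \<open>Every path satisfies the bound 1 - 2\<delta>, hence so does the supremum, which
    is then strictly below 1 - \<delta>.\<close>
  define \<delta> where "\<delta> = min d1 d2 / 2"
  have \<delta>: "0 < \<delta>" "2 * \<delta> \<le> d1" "2 * \<delta> \<le> d2" using d1(1) d2(1) by (auto simp: \<delta>_def)
  from d1(2) d2(2) have "AE \<omega> in M. (SUP P \<in> semi_infinite_vertical_paths_from_origin. ?lim P \<omega>)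
      < ereal (1 - \<delta>)"
  proof eventually_elim
    case (elim \<omega>)
    have "(SUP P \<in> semi_infinite_vertical_paths_from_origin. ?lim P \<omega>) \<le> ereal (1 - 2 * \<delta>)"
    proof (rule SUP_least)
      fix P assume P: "P \<in> semi_infinite_vertical_paths_from_origin"
      from vertical_path_cases(2)[OF P] show "?lim P \<omega> \<le> ereal (1 - 2 * \<delta>)"
      proof
        assume "\<forall>i. (P i, P (Suc i)) \<in> up_edges"
        then have "?lim P \<omega> \<le> ereal (1 - d1)"
          using elim(1)[rule_format, of P] vertical_path_cases(1)[OF P] by simp
        also have "\<dots> \<le> ereal (1 - 2 * \<delta>)" using \<delta> by simp
        finally show ?thesis .
      next
        assume dn: "\<forall>i. (P (Suc i), P i) \<in> up_edges"
        \<comment> \<open>The reflected path goes upwards, and its costs in the reflected field are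
          the costs of \<open>P\<close>.\<close>
        have "(- P i, - P (Suc i)) \<in> up_edges" for i
          using flip_up_edges[OF dn[rule_format, of i]] by (simp add: flip_def)
        then have "?lim P \<omega> \<le> ereal (1 - d2)"
          using elim(2)[rule_format, of "\<lambda>i. - P i"] vertical_path_cases(1)[OF P]
          by (simp add: flip_def insert_commute)
        also have "\<dots> \<le> ereal (1 - 2 * \<delta>)" using \<delta> by simp
        finally show ?thesis .
      qed
    qed
    also have "\<dots> < ereal (1 - \<delta>)" using \<delta> by simp
    finally show ?case .
  qed
  then show ?thesis using \<delta>(1) by blast
qed

end
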